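(* Let $(\mathbf x,B)$ be a seed of $\mathcal F$. Then every cluster variable of $\mathcal A(\mathbf x,B)$ is an irreducible element of the integral domain $\mathcal A(\mathbf x,B)$ (i.e. it is non-invertible and cannot be written as a product of two non-invertible elements of $\mathcal A(\mathbf x,B)$).
   Context: Let $K$ be a field of characteristic $0$ or $K=\mathbb Z$. Fix integers $m\ge p\ge n\ge 1$ with $m>1$, and let $\mathcal F=K(X_1,\dots,X_m)$. For $B=(b_{ij})\in M_{m,n}(\mathbb Z)$ the principal part $B^\circ$ is the $n\times n$ matrix formed by the first $n$ rows. $B$ is connected if the graph with vertices $1,\dots,m$ and an edge between $i$ and $j$ whenever $b_{ij}\neq 0$ or $b_{ji}\ne 0$ is connected. A square integer matrix $A$ is skew-symmetrizable if $DA$ is skew-symmetric for some diagonal integer matrix $D$ with positive diagonal entries. A seed of $\mathcal F$ is a pair $(\mathbf x,B)$ where $B\in M_{m,n}(\mathbb Z)$ is connected with $B^\circ$ skew-symmetrizable, and $\mathbf x=(x_1,\dots,x_m)$ is an $m$-tuple of elements of $\mathcal F$ algebraically independent over $K$. For $1\le k\le n$ the mutation $\mu_k(\mathbf x,B)=(\mathbf x',B')$ is given by $b'_{ij}=-b_{ij}$ if $i=k$ or $j=k$, and $b'_{ij}=b_{ij}+\frac{|b_{ik}|b_{kj}+b_{ik}|b_{kj}|}{2}$ otherwise; $x'_s=x_s$ for $s\neq k$ and $x'_k=x_k^{-1}\big(\prod_{b_{ik}>0}x_i^{b_{ik}}+\prod_{b_{ik}<0}x_i^{-b_{ik}}\big)$.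 Two seeds are mutation equivalent if one is obtained from the other by a finite sequence of mutations $\mu_{i_1},\dots,\mu_{i_t}$ with $1\le i_j\le n$. The cluster algebra $\mathcal A(\mathbf x,B)$ is the $K$-subalgebra of $\mathcal F$ generated by $x_{n+1}^{\pm1},\dots,x_p^{\pm1},x_{p+1},\dots,x_m$ together with all elements $y_1,\dots,y_n$ for all seeds $(\mathbf y,C)$ mutation equivalent to $(\mathbf x,B)$; these $y_i$ ($1\le i\le n$) are the cluster variables. *)

theory Defs
  imports Main
begin

(* Ambient field F = K(X_1,...,X_m) is modelled as a field type 'f of characteristic 0
   together with a base ring K \<subseteq> 'f and elements X 1, ..., X m of 'f that are algebraically
   independent over K and generate 'f as a field over K. Indices run over 1..m (rows)
   and 1..n (columns); values outside these ranges are irrelevant. *)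

definition is_subfield :: "'f::field set \<Rightarrow> bool" where
  "is_subfield K \<longleftrightarrow> 0 \<in> K \<and> 1 \<in> K \<and>
     (\<forall>a\<in>K. \<forall>b\<in>K. a + b \<in> K \<and> a - b \<in> K \<and> a * b \<in> K) \<and>
     (\<forall>a\<in>K. a \<noteq> 0 \<longrightarrow> inverse a \<in> K)"

definition base_ring :: "'f::field_char_0 set \<Rightarrow> bool" where
  "base_ring K \<longleftrightarrow> is_subfield K \<or> K = \<int>"

definition monom_val :: "nat \<Rightarrow> (nat \<Rightarrow> 'f::comm_ring_1) \<Rightarrow> (nat \<Rightarrow> nat) \<Rightarrow> 'f" where
  "monom_val m y e = (\<Prod>i\<in>{1..m}. y i ^ e i)"

definition exps :: "nat \<Rightarrow> (nat \<Rightarrow> nat) set" where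
  "exps m = {e. \<forall>i. i \<notin> {1..m} \<longrightarrow> e i = 0}"

definition alg_indep :: "'f::comm_ring_1 set \<Rightarrow> nat \<Rightarrow> (nat \<Rightarrow> 'f) \<Rightarrow> bool" where
  "alg_indep K m y \<longleftrightarrow>
     (\<forall>S c. finite S \<and> S \<subseteq> exps m \<and> (\<forall>e\<in>S. c e \<in> K) \<and>
        (\<Sum>e\<in>S. c e * monom_val m y e) = 0 \<longrightarrow> (\<forall>e\<in>S. c e = 0))"

definition poly_vals :: "'f::comm_ring_1 set \<Rightarrow> nat \<Rightarrow> (nat \<Rightarrow> 'f) \<Rightarrow> 'f set" where
  "poly_vals K m y = {\<Sum>e\<in>S. c e * monom_val m y e | S c. finite S \<and> (\<forall>e\<in>S. c e \<in> K)}"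

definition rational_function_field :: "'f::field set \<Rightarrow> nat \<Rightarrow> (nat \<Rightarrow> 'f) \<Rightarrow> bool" where
  "rational_function_field K m X \<longleftrightarrow> alg_indep K m X \<and>
     (\<forall>f. \<exists>P\<in>poly_vals K m X. \<exists>Q\<in>poly_vals K m X. Q \<noteq> 0 \<and> f = P / Q)"

definition mat_edge :: "nat \<Rightarrow> nat \<Rightarrow> (nat \<Rightarrow> nat \<Rightarrow> int) \<Rightarrow> nat \<Rightarrow> nat \<Rightarrow> bool" where
  "mat_edge m n B i j \<longleftrightarrow> i \<in> {1..m} \<and> j \<in> {1..m} \<and>
     ((j \<le> n \<and> B i j \<noteq> 0) \<or> (i \<le> n \<and> B j i \<noteq> 0))"

definition connected_mat :: "nat \<Rightarrow> nat \<Rightarrow> (nat \<Rightarrow> nat \<Rightarrow> int) \<Rightarrow> bool" where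
  "connected_mat m n B \<longleftrightarrow> (\<forall>i\<in>{1..m}. \<forall>j\<in>{1..m}. (mat_edge m n B)\<^sup>*\<^sup>* i j)"

definition skew_symmetrizable :: "nat \<Rightarrow> (nat \<Rightarrow> nat \<Rightarrow> int) \<Rightarrow> bool" where
  "skew_symmetrizable n B \<longleftrightarrow> (\<exists>d::nat \<Rightarrow> int. (\<forall>i\<in>{1..n}. d i > 0) \<and>
     (\<forall>i\<in>{1..n}. \<forall>j\<in>{1..n}. d i * B i j = - (d j * B j i)))"

definition is_seed :: "'f::field set \<Rightarrow> nat \<Rightarrow> nat \<Rightarrow> (nat \<Rightarrow> 'f) \<Rightarrow> (nat \<Rightarrow> nat \<Rightarrow> int) \<Rightarrow> bool" where
  "is_seed K m n x B \<longleftrightarrow> connected_mat m n B \<and> skew_symmetrizable n B \<and> alg_indep K m x"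

definition mut_mat :: "nat \<Rightarrow> (nat \<Rightarrow> nat \<Rightarrow> int) \<Rightarrow> nat \<Rightarrow> nat \<Rightarrow> int" where
  "mut_mat k B = (\<lambda>i j. if i = k \<or> j = k then - B i j
      else B i j + (\<bar>B i k\<bar> * B k j + B i k * \<bar>B k j\<bar>) div 2)"

definition mut_clu :: "nat \<Rightarrow> nat \<Rightarrow> (nat \<Rightarrow> 'f::field) \<Rightarrow> (nat \<Rightarrow> nat \<Rightarrow> int) \<Rightarrow> nat \<Rightarrow> 'f" where
  "mut_clu m k x B = x(k := inverse (x k) *
      ((\<Prod>i\<in>{i\<in>{1..m}. B i k > 0}. x i ^ nat (B i k)) +
       (\<Prod>i\<in>{i\<in>{1..m}. B i k < 0}. x i ^ nat (- B i k))))"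

inductive_set mut_equiv :: "nat \<Rightarrow> nat \<Rightarrow> (nat \<Rightarrow> 'f::field) \<Rightarrow> (nat \<Rightarrow> nat \<Rightarrow> int)
    \<Rightarrow> ((nat \<Rightarrow> 'f) \<times> (nat \<Rightarrow> nat \<Rightarrow> int)) set"
  for m n x B where
  refl: "(x, B) \<in> mut_equiv m n x B"
| step: "(y, C) \<in> mut_equiv m n x B \<Longrightarrow> 1 \<le> k \<Longrightarrow> k \<le> n \<Longrightarrow>
           (mut_clu m k y C, mut_mat k C) \<in> mut_equiv m n x B"

definition cluster_variables :: "nat \<Rightarrow> nat \<Rightarrow> (nat \<Rightarrow> 'f::field) \<Rightarrow> (nat \<Rightarrow> nat \<Rightarrow> int) \<Rightarrow> 'f set" where
  "cluster_variables m n x B = {y i | y C i. (y, C) \<in> mut_equiv m n x B \<and> 1 \<le> i \<and> i \<le> n}"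

inductive_set alg_gen :: "'f::comm_ring_1 set \<Rightarrow> 'f set \<Rightarrow> 'f set" for K G where
  base: "a \<in> K \<Longrightarrow> a \<in> alg_gen K G"
| gen: "g \<in> G \<Longrightarrow> g \<in> alg_gen K G"
| add: "a \<in> alg_gen K G \<Longrightarrow> b \<in> alg_gen K G \<Longrightarrow> a + b \<in> alg_gen K G"
| neg: "a \<in> alg_gen K G \<Longrightarrow> - a \<in> alg_gen K G"
| mult: "a \<in> alg_gen K G \<Longrightarrow> b \<in> alg_gen K G \<Longrightarrow> a * b \<in> alg_gen K G"

definition cluster_algebra :: "'f::field set \<Rightarrow> nat \<Rightarrow> nat \<Rightarrow> nat \<Rightarrow> (nat \<Rightarrow> 'f)
    \<Rightarrow> (nat \<Rightarrow> nat \<Rightarrow> int) \<Rightarrow> 'f set" where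
  "cluster_algebra K m p n x B = alg_gen K
     ({x i | i. n < i \<and> i \<le> p} \<union> {inverse (x i) | i. n < i \<and> i \<le> p} \<union>
      {x i | i. p < i \<and> i \<le> m} \<union> cluster_variables m n x B)"

definition unit_in :: "'f::comm_ring_1 set \<Rightarrow> 'f \<Rightarrow> bool" where
  "unit_in A a \<longleftrightarrow> a \<in> A \<and> (\<exists>b\<in>A. a * b = 1)"

definition irreducible_in :: "'f::comm_ring_1 set \<Rightarrow> 'f \<Rightarrow> bool" where
  "irreducible_in A a \<longleftrightarrow> a \<in> A \<and> \<not> unit_in A a \<and>
     (\<forall>b\<in>A. \<forall>c\<in>A. a = b * c \<longrightarrow> unit_in A b \<or> unit_in A c)"

end

theory Submission
  imports Defs "HOL.Rat" "HOL-Library.Poly_Mapping" "HOL-Computational_Algebra.Fraction_Field"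
begin

text \<open>By the Laurent phenomenon the cluster algebra lies, for every seed \<open>(y, C)\<close>, in the ring of Laurent
  polynomials in \<open>y\<close> that are polynomial in the non-inverted frozen variables. If \<open>f g = y\<^sub>k\<close>, then
  \<open>f\<close> and \<open>g\<close> divide a monomial, hence are monomials \<open>u y\<^sup>a\<close> and \<open>v y\<^sup>b\<close>. Expanding them in the
  clusters mutated at each \<open>s \<le> n\<close> shows \<open>a\<^sub>s, b\<^sub>s \<ge> 0\<close>, because the exchange binomial is not a unit.
  As \<open>a + b\<close> is the \<open>k\<close>-th unit vector, one of \<open>f\<close>, \<open>g\<close> is a scalar unit times a monomial in
  inverted frozen variables.

  The Laurent phenomenon follows from the invariance under mutation of the intersection of the Laurent
  rings of a cluster and its neighbours. This is a statement about two mutation directions, which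
  reduces to certain elements being nonzerodivisors modulo an exchange binomial. For commuting
  directions this needs linearly independent columns of the exchange matrix. They are enforced by
  stacking an identity matrix below it, and the additional variables are set to \<open>1\<close> in the end.\<close>

text \<open>A seed over \<open>K\<close> may have linearly dependent exchange columns. Commuting
  directions can then share their exchange polynomial (equal columns, for instance), and no
  coprimality is left to cancel denominators. Expansions are therefore obtained in universal
  variables, with integer coefficients, and substituted into the given seed. Substitution does not
  respect division, so what is transported is the exchange relation cleared of denominators,
  \<open>p * P k = q\<close>, where \<open>p\<close> is the expansion of the new variable. The
  Laurent property alone does not bound the exponents of frozen variables from below. Connectedness
  and \<open>1 < m\<close> enter through one consequence: no column of the exchange matrix is zero,
  so the two exchange monomials differ. For a zero column the relation would read
  \<open>y k * y' k = 2\<close>, and over a field \<open>y k\<close> would be a unit.\<close>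

abbreviation "lookup \<equiv> Poly_Mapping.lookup"
abbreviation "keys \<equiv> Poly_Mapping.keys"
abbreviation "single \<equiv> Poly_Mapping.single"

type_synonym expo = "nat \<Rightarrow>\<^sub>0 int"
type_synonym 'c laurent = "expo \<Rightarrow>\<^sub>0 'c"

subsection \<open>Gradings of Laurent polynomial rings\<close>

lemma poly_mapping_eq_sum_single:
  fixes p :: "'a \<Rightarrow>\<^sub>0 'c::comm_monoid_add"
  shows "p = (\<Sum>e\<in>keys p. single e (lookup p e))"
proof (rule poly_mapping_eqI)
  fix k
  have "lookup (\<Sum>e\<in>keys p. single e (lookup p e)) k
      = (\<Sum>e\<in>keys p. if e = k then lookup p e else 0)"
    by (simp add: lookup_sum lookup_single when_def)
  also have "\<dots> = lookup p k"
    by (simp add: in_keys_iff)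
  finally show "lookup p k = lookup (\<Sum>e\<in>keys p. single e (lookup p e)) k" by simp
qed

lemma poly_mapping_single_induct [case_names zero single add]:
  fixes p :: "'a \<Rightarrow>\<^sub>0 'c::comm_monoid_add"
  assumes "P 0" "\<And>e c. P (single e c)" "\<And>p q. P p \<Longrightarrow> P q \<Longrightarrow> P (p + q)"
  shows "P p"
proof -
  have "P (\<Sum>e\<in>S. single e (lookup p e))" if "finite S" for S
    using that by induction (use assms in auto)
  then show ?thesis
    using poly_mapping_eq_sum_single[of p] finite_keys[of p] by metis
qed

lemma lookup_single_mult:
  fixes q :: "'c::comm_ring_1 laurent"
  shows "lookup (single e c * q) f = c * lookup q (f - e)"
  by (induction q rule: poly_mapping_single_induct)
    (auto simp: mult_single lookup_single when_def lookup_add algebra_simps)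

text \<open>The component of degree \<open>d\<close>. The weight \<open>l\<close> is a parameter
  because coordinates, their negatives and 2 by 2 determinants all serve as gradings.\<close>

definition gpart :: "(expo \<Rightarrow> int) \<Rightarrow> int \<Rightarrow> 'c::comm_ring_1 laurent \<Rightarrow> 'c laurent" where
  "gpart l d p = (\<Sum>e\<in>{e\<in>keys p. l e = d}. single e (lookup p e))"

lemma lookup_gpart: "lookup (gpart l d p) e = (if l e = d then lookup p e else 0)"
proof -
  have "lookup (gpart l d p) e = (\<Sum>f\<in>{f\<in>keys p. l f = d}. if f = e then lookup p f else 0)"
    by (simp add: gpart_def lookup_sum lookup_single when_def)
  then show ?thesis by (auto simp: in_keys_iff)
qed

lemma gpart_0 [simp]: "gpart l d 0 = 0"
  by (rule poly_mapping_eqI) (simp add: lookup_gpart)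

lemma gpart_add: "gpart l d (p + q) = gpart l d p + gpart l d q"
  by (rule poly_mapping_eqI) (simp add: lookup_gpart lookup_add)

lemma gpart_sum: "gpart l d (sum f S) = (\<Sum>i\<in>S. gpart l d (f i))"
  by (induction S rule: infinite_finite_induct) (simp_all add: gpart_add)

lemma gpart_eq_0: "(\<And>e. e \<in> keys p \<Longrightarrow> l e \<noteq> d) \<Longrightarrow> gpart l d p = 0"
  by (rule poly_mapping_eqI) (auto simp: lookup_gpart in_keys_iff)

lemma gpart_neq_0: "e \<in> keys p \<Longrightarrow> l e = d \<Longrightarrow> gpart l d p \<noteq> 0"
  by (metis in_keys_iff lookup_gpart lookup_zero)

lemma sum_gpart: "p = (\<Sum>d\<in>l ` keys p. gpart l d p)"
  by (rule poly_mapping_eqI) (auto simp: lookup_gpart lookup_sum in_keys_iff)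

definition homogeneous :: "(expo \<Rightarrow> int) \<Rightarrow> int \<Rightarrow> 'c::comm_ring_1 laurent \<Rightarrow> bool" where
  "homogeneous l a p \<longleftrightarrow> (\<forall>e\<in>keys p. l e = a)"

lemma homogeneous_gpart: "homogeneous l a p \<Longrightarrow> gpart l a p = p"
  by (rule poly_mapping_eqI) (auto simp: lookup_gpart homogeneous_def in_keys_iff)

locale grading =
  fixes l :: "expo \<Rightarrow> int"
  assumes l_add: "l (e + f) = l e + l f"
begin

lemma l_diff: "l (e - f) = l e - l f"
  using l_add[of "e - f" f] by simp

lemma gpart_single_mult: "gpart l d (single e c * q) = single e c * gpart l (d - l e) q"
  by (rule poly_mapping_eqI) (auto simp: lookup_gpart lookup_single_mult l_diff)

lemma gpart_mult:
  "gpart l d (p * q) = (\<Sum>e\<in>keys p. single e (lookup p e) * gpart l (d - l e) q)"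
proof -
  have "gpart l d (p * q) = gpart l d (\<Sum>e\<in>keys p. single e (lookup p e) * q)"
    by (subst (1) poly_mapping_eq_sum_single[of p]) (simp add: sum_distrib_right)
  then show ?thesis by (simp add: gpart_sum gpart_single_mult)
qed

lemma gpart_homogeneous_mult:
  assumes "homogeneous l a p"
  shows "gpart l d (p * q) = p * gpart l (d - a) q"
proof -
  have "gpart l d (p * q) = (\<Sum>e\<in>keys p. single e (lookup p e) * gpart l (d - a) q)"
    unfolding gpart_mult using assms by (intro sum.cong) (auto simp: homogeneous_def)
  also have "\<dots> = p * gpart l (d - a) q"
    by (subst (3) poly_mapping_eq_sum_single[of p]) (simp add: sum_distrib_right)
  finally show ?thesis .
qed

text \<open>Only products of lowest components reach degree \<open>a + b\<close>. The numbers
  \<open>a\<close> and \<open>b\<close> are mere lower bounds, so either component may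
  vanish.\<close>

lemma gpart_mult_lowest:
  assumes "\<And>e. e \<in> keys p \<Longrightarrow> a \<le> l e" "\<And>e. e \<in> keys q \<Longrightarrow> b \<le> l e"
  shows "gpart l (a + b) (p * q) = gpart l a p * gpart l b q"
proof -
  have "gpart l (a + b) (p * q)
      = (\<Sum>e\<in>keys p. if l e = a then single e (lookup p e) * gpart l b q else 0)"
    unfolding gpart_mult
  proof (rule sum.cong[OF HOL.refl])
    fix e assume e: "e \<in> keys p"
    have "gpart l (a + b - l e) q = 0" if "l e \<noteq> a"
      by (rule gpart_eq_0) (use assms(1)[OF e] assms(2) that in force)
    then show "single e (lookup p e) * gpart l (a + b - l e) q
        = (if l e = a then single e (lookup p e) * gpart l b q else 0)" by auto
  qed
  also have "\<dots> = gpart l a p * gpart l b q"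
    unfolding gpart_def[of l a p] sum_distrib_right
    by (rule sum.mono_neutral_cong_right) auto
  finally show ?thesis .
qed

lemma grading_uminus: "grading (\<lambda>e. - l e)"
  by unfold_locales (simp add: l_add)

text \<open>Homogeneity of \<open>P\<close> lets divisibility be read off degree by degree. In the
  degree of the lowest component of \<open>h\<close> that \<open>P\<close> does not divide, the
  product is this component plus a multiple of a lower one, which \<open>P\<close> divides; so
  \<open>P\<close> divides it after all.\<close>

lemma homogeneous_dvd_aux:
  fixes P h :: "'c::comm_ring_1 laurent"
  assumes P: "homogeneous l a P" and b: "l \<beta> > 0" and dvd: "P dvd (1 + single \<beta> c) * h"
  shows "P dvd h"
proof -
  have "P dvd gpart l d h" for d
  proof (rule ccontr)
    assume nd: "\<not> P dvd gpart l d h"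
    define D where "D = {d \<in> l ` keys h. \<not> P dvd gpart l d h}"
    have D: "d \<in> D \<longleftrightarrow> \<not> P dvd gpart l d h" for d
    proof -
      have "gpart l d h = 0" if "d \<notin> l ` keys h"
        by (rule gpart_eq_0) (use that in auto)
      then show ?thesis unfolding D_def by (metis (no_types, lifting) dvd_0_right mem_Collect_eq)
    qed
    have "finite D" by (simp add: D_def)
    define d0 where "d0 = Min D"
    have d0: "d0 \<in> D" using \<open>finite D\<close> nd D by (metis Min_in d0_def empty_iff)
    have "d0 - l \<beta> \<notin> D"
      using Min_le[OF \<open>finite D\<close>, of "d0 - l \<beta>"] b by (auto simp: d0_def)
    then have 1: "P dvd single \<beta> c * gpart l (d0 - l \<beta>) h" using D by auto
    obtain r where r: "(1 + single \<beta> c) * h = P * r" using dvd by auto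
    have "gpart l d0 ((1 + single \<beta> c) * h)
        = gpart l d0 h + single \<beta> c * gpart l (d0 - l \<beta>) h"
      by (simp add: distrib_right gpart_add gpart_single_mult)
    moreover have "gpart l d0 (P * r) = P * gpart l (d0 - a) r"
      using gpart_homogeneous_mult[OF P, of d0 r] by simp
    ultimately have "P dvd gpart l d0 h + single \<beta> c * gpart l (d0 - l \<beta>) h"
      using r by (metis dvd_triv_left)
    then have "P dvd gpart l d0 h" using 1 by (simp add: dvd_add_left_iff)
    then show False using d0 D by simp
  qed
  then have "P dvd (\<Sum>d\<in>l ` keys h. gpart l d h)" by (intro dvd_sum)
  then show ?thesis using sum_gpart[of h l] by simp
qed

end

lemma homogeneous_uminus: "homogeneous (\<lambda>e. - l e) (- a) p = homogeneous l a p"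
  by (simp add: homogeneous_def)

lemma (in grading) homogeneous_dvd:
  fixes P h :: "'c::comm_ring_1 laurent"
  assumes P: "homogeneous l a P" and b: "l \<beta> \<noteq> 0" and dvd: "P dvd (1 + single \<beta> c) * h"
  shows "P dvd h"
proof (cases "l \<beta> > 0")
  case False
  interpret neg: grading "\<lambda>e. - l e" by (rule grading_uminus)
  show ?thesis
    by (rule neg.homogeneous_dvd_aux[OF _ _ dvd])
      (use P b False homogeneous_uminus[of l a P] in auto)
qed (use homogeneous_dvd_aux assms in auto)

lemma grading_lookup: "grading (\<lambda>e. lookup e i)"
  by unfold_locales (simp add: lookup_add)

text \<open>In a domain the lowest components have a nonzero product, so the degree in which it sits
  must be that of the monomial.\<close>

lemma (in grading) lowest_degree_mult:
  fixes p q :: "'c::idom laurent"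
  assumes "p \<noteq> 0" "q \<noteq> 0" "p * q = single e c"
  shows "l e = Min (l ` keys p) + Min (l ` keys q)"
proof -
  let ?a = "Min (l ` keys p)" and ?b = "Min (l ` keys q)"
  have "?a \<in> l ` keys p" "?b \<in> l ` keys q" using assms by (auto intro!: Min_in)
  then have "gpart l ?a p \<noteq> 0" "gpart l ?b q \<noteq> 0" using gpart_neq_0 by (metis imageE)+
  moreover have "gpart l (?a + ?b) (p * q) = gpart l ?a p * gpart l ?b q"
    by (rule gpart_mult_lowest) auto
  ultimately have "gpart l (?a + ?b) (single e c) \<noteq> 0" using assms by simp
  then show ?thesis using gpart_eq_0[of "single e c" l "?a + ?b"]
    by (metis empty_iff insert_iff keys_single)
qed

text \<open>In each coordinate the minimal degrees of \<open>p\<close> and \<open>q\<close> add up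
  to the degree of the monomial, and by the opposite grading so do the maximal ones. Hence minimum
  and maximum agree on each factor, and all exponents of \<open>p\<close> coincide.\<close>

lemma factor_of_single:
  fixes p q :: "'c::idom laurent"
  assumes pq: "p * q = single e c" and c: "c \<noteq> 0"
  obtains a u where "p = single a u" "u \<noteq> 0"
proof -
  have nz: "p \<noteq> 0" "q \<noteq> 0" using assms by (metis mult_zero_left mult_zero_right
      lookup_single_eq lookup_zero)+
  have same: "lookup f i = lookup g i" if f: "f \<in> keys p" "g \<in> keys p" for f g i
  proof -
    let ?l = "\<lambda>e::expo. lookup e i"
    interpret l: grading ?l by (rule grading_lookup)
    interpret n: grading "\<lambda>e. - ?l e" by (rule l.grading_uminus)
    have "?l e = Min (?l ` keys p) + Min (?l ` keys q)"
      by (rule l.lowest_degree_mult[OF nz pq])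
    moreover have "- ?l e = Min ((\<lambda>e. - ?l e) ` keys p) + Min ((\<lambda>e. - ?l e) ` keys q)"
      by (rule n.lowest_degree_mult[OF nz pq])
    moreover have "Min (?l ` keys p) \<le> ?l h \<and> Min ((\<lambda>e. - ?l e) ` keys p) \<le> - ?l h"
      if "h \<in> keys p" for h using that by (auto intro!: Min_le)
    moreover obtain h where "h \<in> keys q" using nz by (metis all_not_in_conv keys_eq_empty)
    moreover have "Min (?l ` keys q) \<le> ?l h \<and> Min ((\<lambda>e. - ?l e) ` keys q) \<le> - ?l h"
      if "h \<in> keys q" for h using that by (auto intro!: Min_le)
    ultimately show ?thesis using f by (smt (verit))
  qed
  obtain a where a: "a \<in> keys p" using nz by (metis all_not_in_conv keys_eq_empty)
  have "keys p = {a}" using same a by (auto intro: poly_mapping_eqI)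
  then have "p = single a (lookup p a)" using poly_mapping_eq_sum_single[of p] by simp
  moreover have "lookup p a \<noteq> 0" using a by (simp add: in_keys_iff)
  ultimately show ?thesis using that by blast
qed

lemma binomial_not_factor:
  fixes q :: "'c::idom laurent"
  assumes "a \<noteq> b" "c \<noteq> 0"
  shows "(single a 1 + single b 1) * q \<noteq> single e c"
proof
  assume "(single a 1 + single b 1) * q = single e c"
  then obtain f u where f: "single a 1 + single b 1 = single f (u::'c)"
    using factor_of_single assms(2) by metis
  have "lookup (single a 1 + single b (1::'c)) a = 1" "lookup (single a 1 + single b (1::'c)) b = 1"
    using assms by (auto simp: lookup_add lookup_single when_def)
  then show False unfolding f using assms by (auto simp: lookup_single when_def split: if_splits)
qed

text \<open>A substitute for coprimality: \<open>q\<close> is a nonzerodivisor modulo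
  \<open>p\<close>. It can be verified with gradings, without factorisation theory.\<close>

definition nzd_mod :: "'a::comm_ring_1 \<Rightarrow> 'a \<Rightarrow> bool" where
  "nzd_mod p q \<longleftrightarrow> (\<forall>h. p dvd q * h \<longrightarrow> p dvd h)"

lemma nzd_mod_mult:
  assumes "nzd_mod p q" "nzd_mod p r"
  shows "nzd_mod p (q * r)"
  unfolding nzd_mod_def
proof (intro allI impI)
  fix h assume "p dvd q * r * h"
  then have "p dvd q * (r * h)" by (simp only: mult.assoc)
  then show "p dvd h" using assms unfolding nzd_mod_def by blast
qed

lemma nzd_mod_power: "nzd_mod p q \<Longrightarrow> nzd_mod p (q ^ n)"
proof (induction n)
  case 0
  show ?case by (simp add: nzd_mod_def)
next
  case (Suc n)
  then show ?case unfolding power_Suc by (intro nzd_mod_mult)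
qed

lemma nzd_mod_add:
  assumes "nzd_mod p q"
  shows "nzd_mod p (q + p * r)"
  unfolding nzd_mod_def
proof (intro allI impI)
  fix h assume "p dvd (q + p * r) * h"
  then have "p dvd q * h + p * (r * h)" by (simp only: distrib_right mult.assoc)
  then have "p dvd q * h" using dvd_add_left_iff dvd_triv_left by blast
  then show "p dvd h" using assms unfolding nzd_mod_def by blast
qed

text \<open>The factors \<open>p\<close> are split off \<open>h\<close> and cancelled one at a
  time.\<close>

lemma nzd_mod_power_left:
  fixes p :: "'a::idom"
  assumes "nzd_mod p q" "p \<noteq> 0"
  shows "nzd_mod (p ^ n) q"
proof (induction n)
  case (Suc n)
  show ?case unfolding nzd_mod_def
  proof (intro allI impI)
    fix h assume h: "p ^ Suc n dvd q * h"
    then have "p dvd q * h" by (metis dvd_mult_left power_Suc)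
    then obtain h' where h': "h = p * h'" using assms(1) unfolding nzd_mod_def by (metis dvdE)
    then have "p * p ^ n dvd p * (q * h')" using h by (simp add: mult.left_commute)
    then have "p ^ n dvd q * h'" using assms(2) by simp
    then have "p ^ n dvd h'" using Suc unfolding nzd_mod_def by blast
    then show "p ^ Suc n dvd h" by (simp add: h' mult_dvd_mono)
  qed
qed (simp add: nzd_mod_def)

lemma nzd_mod_single: "nzd_mod p (single e (1::'c::comm_ring_1) :: 'c laurent)"
  unfolding nzd_mod_def
proof (intro allI impI)
  fix h assume "p dvd single e 1 * h"
  then have "p dvd single (- e) 1 * (single e 1 * h)" by (rule dvd_mult)
  then show "p dvd h" by (simp add: mult.assoc[symmetric] mult_single)
qed

text \<open>The monomial with exponent \<alpha> is invertible; dividing by it leaves a binomial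
  \<open>1 + single (\<beta> - \<alpha>) c\<close> of nonzero weight, to which
  \<open>homogeneous_dvd\<close> applies.\<close>

lemma (in grading) nzd_mod_binomial:
  fixes p :: "'c::comm_ring_1 laurent"
  assumes "homogeneous l a p" "l \<alpha> \<noteq> l \<beta>"
  shows "nzd_mod p (single \<alpha> 1 + single \<beta> c)"
proof -
  have eq: "single \<alpha> 1 + single \<beta> c = (1 + single (\<beta> - \<alpha>) c) * single \<alpha> 1"
    by (simp add: distrib_right mult_single)
  have "l (\<beta> - \<alpha>) \<noteq> 0" using assms(2) by (simp add: l_diff)
  then have "nzd_mod p (1 + single (\<beta> - \<alpha>) c)"
    unfolding nzd_mod_def using homogeneous_dvd[OF assms(1)] by blast
  then show ?thesis unfolding eq by (rule nzd_mod_mult[OF _ nzd_mod_single])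
qed

subsection \<open>Evaluation of Laurent polynomials\<close>

definition mon :: "(nat \<Rightarrow> 'f::field) \<Rightarrow> expo \<Rightarrow> 'f" where
  "mon y e = (\<Prod>i\<in>keys e. y i powi lookup e i)"

lemma mon_superset:
  assumes "finite S" "keys e \<subseteq> S"
  shows "mon y e = (\<Prod>i\<in>S. y i powi lookup e i)"
  unfolding mon_def by (rule prod.mono_neutral_left) (use assms in \<open>auto simp: in_keys_iff\<close>)

lemma mon_0 [simp]: "mon y 0 = 1"
  by (simp add: mon_def)

lemma mon_single [simp]: "mon y (single i a) = y i powi a"
  by (simp add: mon_def)

lemma nonzero_at: "0 \<notin> range y \<Longrightarrow> y i \<noteq> 0"
  by (metis rangeI)

lemma mon_add:
  assumes "0 \<notin> range y"
  shows "mon y (e + f) = mon y e * mon y f"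
proof -
  let ?S = "keys e \<union> keys f"
  have "keys (e + f) \<subseteq> ?S" by (rule Poly_Mapping.keys_add)
  then have "mon y (e + f) = (\<Prod>i\<in>?S. y i powi lookup e i * y i powi lookup f i)"
    using assms by (simp add: mon_superset[of ?S] lookup_add power_int_add nonzero_at)
  then show ?thesis by (simp add: prod.distrib mon_superset[of ?S])
qed

lemma mon_neq_0:
  assumes "0 \<notin> range y"
  shows "mon y e \<noteq> 0"
  using assms by (simp add: mon_def nonzero_at)

lemma mon_diff:
  assumes "0 \<notin> range y"
  shows "mon y (e - f) = mon y e / mon y f"
  using mon_add[OF assms, of "e - f" f] mon_neq_0[OF assms, of f] by (simp add: field_simps)

lemma mon_uminus:
  assumes "0 \<notin> range y"
  shows "mon y (- f) = inverse (mon y f)"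
  using mon_diff[OF assms, of 0 f] by (simp add: field_simps)

lemma mon_cong: "(\<And>i. i \<in> keys e \<Longrightarrow> y i = z i) \<Longrightarrow> mon y e = mon z e"
  by (simp add: mon_def)

lemma mon_upd:
  assumes "lookup e k = 0"
  shows "mon (y(k := v)) e = mon y e"
  by (rule mon_cong) (use assms in \<open>auto simp: in_keys_iff\<close>)

lemma mon_split:
  assumes "0 \<notin> range y"
  shows "mon y e = mon y (e - single k (lookup e k)) * y k powi lookup e k"
  using mon_add[OF assms, of "e - single k (lookup e k)" "single k (lookup e k)"] by simp

lemma mon_smult_nat:
  assumes "0 \<notin> range y" "\<And>i. lookup f i = int n * lookup e i"
  shows "mon y f = mon y e ^ n"
proof -
  have "lookup (\<Sum>i<n. e) j = int n * lookup e j" for j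
    by (induction n) (simp_all add: lookup_add algebra_simps del: sum_constant)
  then have "f = (\<Sum>i<n. e)"
    by (intro poly_mapping_eqI) (simp only: assms)
  moreover have "mon y (\<Sum>i<n. e) = mon y e ^ n"
    by (induction n) (simp_all add: mon_add[OF assms(1)] del: sum_constant)
  ultimately show ?thesis by simp
qed

text \<open>Formal coefficients and values are kept apart because evaluation occurs in four
  settings: integers into the universal field, into the rationals for augmentation, into the ambient
  field for specialisation, and the identity of the ambient field.\<close>

locale coef_hom =
  fixes \<kappa> :: "'c::idom \<Rightarrow> 'f::field"
  assumes \<kappa>_add: "\<kappa> (a + b) = \<kappa> a + \<kappa> b"
    and \<kappa>_mult: "\<kappa> (a * b) = \<kappa> a * \<kappa> b"
    and \<kappa>_1: "\<kappa> 1 = 1"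
begin

lemma \<kappa>_0: "\<kappa> 0 = 0"
  by (metis \<kappa>_add add_cancel_right_right)

definition lev :: "(nat \<Rightarrow> 'f) \<Rightarrow> 'c laurent \<Rightarrow> 'f" where
  "lev y p = (\<Sum>e\<in>keys p. \<kappa> (lookup p e) * mon y e)"

lemma lev_superset:
  assumes "finite S" "keys p \<subseteq> S"
  shows "lev y p = (\<Sum>e\<in>S. \<kappa> (lookup p e) * mon y e)"
  unfolding lev_def
  by (rule sum.mono_neutral_left) (use assms in \<open>auto simp: in_keys_iff \<kappa>_0\<close>)

lemma lev_0 [simp]: "lev y 0 = 0"
  by (simp add: lev_def)

lemma lev_add: "lev y (p + q) = lev y p + lev y q"
proof -
  let ?S = "keys p \<union> keys q"
  have "keys (p + q) \<subseteq> ?S" by (rule Poly_Mapping.keys_add)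
  then show ?thesis
    by (simp add: lev_superset[of ?S] lookup_add \<kappa>_add sum.distrib distrib_right)
qed

lemma lev_uminus: "lev y (- p) = - lev y p"
  using lev_add[of y "- p" p] by (simp add: eq_neg_iff_add_eq_0)

lemma lev_diff: "lev y (p - q) = lev y p - lev y q"
  using lev_add[of y "p - q" q] by simp

lemma lev_sum: "lev y (sum f S) = (\<Sum>i\<in>S. lev y (f i))"
  by (induction S rule: infinite_finite_induct) (simp_all add: lev_add)

lemma lev_single: "lev y (single e c) = \<kappa> c * mon y e"
  by (cases "c = 0") (simp_all add: lev_def \<kappa>_0)

lemma lev_single_1 [simp]: "lev y (single e 1) = mon y e"
  by (simp add: lev_single \<kappa>_1)

lemma lev_1 [simp]: "lev y 1 = 1"
  using lev_single_1[of y 0] by simp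

lemma lev_mult:
  assumes "0 \<notin> range y"
  shows "lev y (p * q) = lev y p * lev y q"
proof (induction p rule: poly_mapping_single_induct)
  case (single e c)
  show ?case
    by (induction q rule: poly_mapping_single_induct)
      (simp_all add: mult_single lev_single lev_add mon_add[OF assms] \<kappa>_mult distrib_left)
qed (simp_all add: lev_add distrib_right)

lemma lev_power:
  assumes "0 \<notin> range y"
  shows "lev y (p ^ n) = lev y p ^ n"
  by (induction n) (simp_all add: lev_mult[OF assms])

lemma lev_prod:
  assumes "0 \<notin> range y"
  shows "lev y (prod f S) = (\<Prod>i\<in>S. lev y (f i))"
  by (induction S rule: infinite_finite_induct) (simp_all add: lev_mult[OF assms])

end

section \<open>Laurent polynomials with restricted coefficients and exponents\<close>

definition subring_set :: "'c::comm_ring_1 set \<Rightarrow> bool" where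
  "subring_set K \<longleftrightarrow> 0 \<in> K \<and> 1 \<in> K \<and> (\<forall>a\<in>K. \<forall>b\<in>K. a + b \<in> K \<and> a * b \<in> K \<and> - a \<in> K)"

definition submonoid :: "expo set \<Rightarrow> bool" where
  "submonoid E \<longleftrightarrow> 0 \<in> E \<and> (\<forall>e\<in>E. \<forall>f\<in>E. e + f \<in> E)"

definition lring :: "'c::comm_ring_1 set \<Rightarrow> expo set \<Rightarrow> 'c laurent set" where
  "lring K E = {p. keys p \<subseteq> E \<and> (\<forall>e. lookup p e \<in> K)}"

locale laurent_ring =
  fixes K :: "'c::comm_ring_1 set" and E :: "expo set"
  assumes K: "subring_set K" and E: "submonoid E"
begin

lemma lring_0: "0 \<in> lring K E"
  using K by (simp add: lring_def subring_set_def)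

lemma lring_single: "c \<in> K \<Longrightarrow> e \<in> E \<Longrightarrow> single e c \<in> lring K E"
  using K by (auto simp: lring_def subring_set_def lookup_single when_def)

lemma lring_single_1: "e \<in> E \<Longrightarrow> single e 1 \<in> lring K E"
  using K by (intro lring_single) (auto simp: subring_set_def)

lemma lring_1: "1 \<in> lring K E"
  using lring_single_1[of 0] E by (simp add: submonoid_def)

lemma lring_add: "p \<in> lring K E \<Longrightarrow> q \<in> lring K E \<Longrightarrow> p + q \<in> lring K E"
  using K Poly_Mapping.keys_add[of p q] unfolding lring_def subring_set_def
  by (auto simp: lookup_add)

lemma lring_uminus: "p \<in> lring K E \<Longrightarrow> - p \<in> lring K E"
  using K unfolding lring_def subring_set_def by (auto simp: in_keys_iff)

lemma lring_sum: "(\<And>i. i \<in> S \<Longrightarrow> f i \<in> lring K E) \<Longrightarrow> sum f S \<in> lring K E"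
  by (induction S rule: infinite_finite_induct) (auto simp: lring_0 lring_add)

lemma lring_mult:
  assumes "p \<in> lring K E" "q \<in> lring K E"
  shows "p * q \<in> lring K E"
proof -
  have "p * q = (\<Sum>e\<in>keys p. \<Sum>f\<in>keys q. single (e + f) (lookup p e * lookup q f))"
    by (subst (1) poly_mapping_eq_sum_single[of p], subst (1) poly_mapping_eq_sum_single[of q])
      (simp add: sum_product mult_single)
  also have "\<dots> \<in> lring K E"
    by (intro lring_sum lring_single)
      (use assms K E in \<open>auto simp: lring_def subring_set_def submonoid_def subset_iff\<close>)
  finally show ?thesis .
qed

lemma lring_power: "p \<in> lring K E \<Longrightarrow> p ^ n \<in> lring K E"
  by (induction n) (auto simp: lring_1 lring_mult)

end

definition supp_in :: "nat set \<Rightarrow> expo set" where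
  "supp_in V = {e. keys e \<subseteq> V}"

lemma supp_in_UNIV [simp]: "supp_in UNIV = UNIV"
  by (simp add: supp_in_def)

lemma lring_UNIV [simp]: "lring UNIV UNIV = UNIV"
  by (simp add: lring_def)

lemma submonoid_supp_in: "submonoid (supp_in V)"
  unfolding submonoid_def supp_in_def using Poly_Mapping.keys_add by fastforce

subsection \<open>Algebraic independence under mutation\<close>

text \<open>If \<open>Q\<close> does not involve the \<open>k\<close>-th variable, a Laurent polynomial in \<open>y\<^sub>k' = Q / y\<^sub>k\<close> and the
  other variables becomes, after multiplication by \<open>Q\<^sup>N\<close>, one in \<open>y\<close> whose coefficient at
  \<open>y\<^sub>k\<^sup>-\<^sup>d\<close> is the coefficient at \<open>y\<^sub>k'\<^sup>d\<close> times a power of \<open>Q\<close>.\<close>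

definition flip :: "nat \<Rightarrow> expo \<Rightarrow> expo" where
  "flip k e = e - single k (2 * lookup e k)"

lemma lookup_flip: "lookup (flip k e) i = (if i = k then - lookup e i else lookup e i)"
  by (auto simp: flip_def lookup_minus lookup_single when_def)

lemma flip_flip [simp]: "flip k (flip k e) = e"
  by (rule poly_mapping_eqI) (simp add: lookup_flip)

lemma keys_flip: "keys (flip k e) = keys e"
  by (auto simp: in_keys_iff lookup_flip split: if_splits)

lemma (in coef_hom) exchange_preserves_indep:
  assumes K: "subring_set K"
    and nz: "0 \<notin> range y"
    and inj: "\<And>p. p \<in> lring K (supp_in V) \<Longrightarrow> lev y p = 0 \<Longrightarrow> p = 0"
    and q: "q \<in> lring K (supp_in V)" "q \<noteq> 0" "homogeneous (\<lambda>e. lookup e k) 0 q"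
    and y': "y' = y(k := inverse (y k) * lev y q)"
    and p: "p \<in> lring K (supp_in V)" "lev y' p = 0"
  shows "p = 0"
proof -
  interpret laurent_ring K "supp_in V"
    by unfold_locales (use K submonoid_supp_in in auto)
  interpret l: grading "\<lambda>e. lookup e k" by (rule grading_lookup)
  define Q where "Q = lev y q"
  have Q: "Q \<noteq> 0" using inj q unfolding Q_def by blast
  \<comment> \<open>No exponent of \<open>y' k\<close> in \<open>p\<close> is below
    \<open>- N\<close>, so multiplication by \<open>Q ^ N\<close> leaves only nonnegative powers of
    \<open>Q\<close>.\<close>
  define N where "N = (\<Sum>e\<in>keys p. nat \<bar>lookup e k\<bar>)"
  have N: "lookup e k + int N \<ge> 0" if "e \<in> keys p" for e
  proof -
    have "nat \<bar>lookup e k\<bar> \<le> N" unfolding N_def by (rule member_le_sum) (use that in auto)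
    then show ?thesis by linarith
  qed
  define \<sigma> where "\<sigma> = (\<Sum>e\<in>keys p. single (flip k e) (lookup p e) * q ^ nat (lookup e k + int N))"
  have mon: "mon y (flip k e) * Q ^ nat (lookup e k + int N) = Q ^ N * mon y' e" if "e \<in> keys p" for e
  proof -
    have nz': "0 \<notin> range y'" using nz Q nonzero_at[OF nz] by (auto simp: y' Q_def)
    have yk: "y' k = Q / y k" by (simp add: y' Q_def divide_inverse mult.commute)
    have *: "lookup (e - single k (lookup e k)) k = 0" by (simp add: lookup_minus)
    have "mon y' e = mon y' (e - single k (lookup e k)) * y' k powi lookup e k"
      by (rule mon_split[OF nz'])
    also have "mon y' (e - single k (lookup e k)) = mon y (e - single k (lookup e k))"
      unfolding y' by (rule mon_upd[OF *])
    finally have 1: "mon y' e = mon y (e - single k (lookup e k)) * (Q / y k) powi lookup e k"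
      by (simp only: yk)
    have "flip k e - single k (lookup (flip k e) k) = e - single k (lookup e k)"
      by (rule poly_mapping_eqI) (auto simp: lookup_flip lookup_minus lookup_single when_def)
    then have 2: "mon y (flip k e)
        = mon y (e - single k (lookup e k)) * y k powi (- lookup e k)"
      using mon_split[OF nz, of "flip k e" k] by (simp add: lookup_flip)
    have "Q ^ nat (lookup e k + int N) = Q powi (lookup e k + int N)"
      using N[OF that] by (metis int_nat_eq power_int_of_nat)
    also have "\<dots> = Q powi lookup e k * Q ^ N"
      using Q by (simp add: power_int_add)
    finally show ?thesis
      unfolding 1 2 by (simp add: power_int_divide_distrib power_int_minus field_simps)
  qed
  have "lev y \<sigma> = (\<Sum>e\<in>keys p. \<kappa> (lookup p e) * (mon y (flip k e) * Q ^ nat (lookup e k + int N)))"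
    unfolding \<sigma>_def Q_def by (simp add: lev_sum lev_mult[OF nz] lev_power[OF nz] lev_single mult.assoc)
  also have "\<dots> = (\<Sum>e\<in>keys p. Q ^ N * (\<kappa> (lookup p e) * mon y' e))"
    by (intro sum.cong HOL.refl) (simp add: mon)
  also have "\<dots> = Q ^ N * lev y' p" by (simp add: lev_def sum_distrib_left)
  finally have "lev y \<sigma> = 0" using p by simp
  moreover have "\<sigma> \<in> lring K (supp_in V)"
    unfolding \<sigma>_def using p q by (intro lring_sum lring_mult lring_power lring_single)
      (auto simp: lring_def supp_in_def keys_flip)
  ultimately have \<sigma>: "\<sigma> = 0" using inj by blast
  have hq: "homogeneous (\<lambda>e. lookup e k) 0 (q ^ n)" for n
  proof (induction n)
    case (Suc n)
    show ?case unfolding homogeneous_def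
    proof
      fix e assume "e \<in> keys (q ^ Suc n)"
      then obtain a b where "e = a + b" "a \<in> keys q" "b \<in> keys (q ^ n)"
        using keys_mult[of q "q ^ n"] by auto
      then show "lookup e k = 0" using Suc q(3) by (simp add: homogeneous_def lookup_add)
    qed
  qed (simp add: homogeneous_def)
  show "p = 0"
  proof (rule poly_mapping_eqI)
    fix e0 show "lookup p e0 = lookup 0 e0"
    proof (cases "e0 \<in> keys p")
      case True
      define d where "d = lookup e0 k"
      define S where "S = {e\<in>keys p. lookup e k = d}"
      \<comment> \<open>Powers of \<open>q\<close> have degree 0 in the variable \<open>k\<close>.
        Thus only exponents with \<open>lookup e k = d\<close> contribute to degree
        \<open>- d\<close>, all with the same power of \<open>q\<close>, which then cancels.\<close>
      have "0 = gpart (\<lambda>e. lookup e k) (- d) \<sigma>" using \<sigma> by simp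
      also have "\<dots> = (\<Sum>e\<in>keys p. single (flip k e) (lookup p e) *
          gpart (\<lambda>e. lookup e k) (- d + lookup e k) (q ^ nat (lookup e k + int N)))"
        unfolding \<sigma>_def by (simp add: gpart_sum l.gpart_single_mult lookup_flip)
      also have "\<dots> = (\<Sum>e\<in>S. single (flip k e) (lookup p e) * q ^ nat (d + int N))"
      proof (rule sum.mono_neutral_cong_right)
        show "\<forall>e\<in>keys p - S. single (flip k e) (lookup p e) *
          gpart (\<lambda>e. lookup e k) (- d + lookup e k) (q ^ nat (lookup e k + int N)) = 0"
        proof
          fix e assume "e \<in> keys p - S"
          then have "gpart (\<lambda>e. lookup e k) (- d + lookup e k) (q ^ nat (lookup e k + int N)) = 0"
            using hq by (intro gpart_eq_0) (force simp: S_def homogeneous_def)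
          then show "single (flip k e) (lookup p e) *
            gpart (\<lambda>e. lookup e k) (- d + lookup e k) (q ^ nat (lookup e k + int N)) = 0" by simp
        qed
      qed (auto simp: S_def homogeneous_gpart[OF hq])
      also have "\<dots> = (\<Sum>e\<in>S. single (flip k e) (lookup p e)) * q ^ nat (d + int N)"
        by (simp add: sum_distrib_right)
      finally have "(\<Sum>e\<in>S. single (flip k e) (lookup p e)) = 0" using q by simp
      then have "0 = lookup (\<Sum>e\<in>S. single (flip k e) (lookup p e)) (flip k e0)" by simp
      also have "\<dots> = (\<Sum>e\<in>S. if e = e0 then lookup p e else 0)"
        unfolding lookup_sum lookup_single when_def
        by (intro sum.cong HOL.refl) (metis flip_flip)
      also have "\<dots> = lookup p e0" using True by (simp add: S_def d_def)
      finally show ?thesis by simp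
    qed (simp add: in_keys_iff)
  qed
qed

subsection \<open>Matrix mutation\<close>

text \<open>The numerator is twice an integer in each sign case. The form with positive parts is
  free of division and refers to the exponents of the exchange monomials.\<close>

lemma mutation_term:
  "(\<bar>a\<bar> * b + a * \<bar>b\<bar>) div 2 = max 0 a * max 0 b - max 0 (- a) * max 0 (- b)" for a b :: int
  by (cases "a \<ge> 0"; cases "b \<ge> 0") (auto simp: max_def)

lemma mut_mat_alt:
  "mut_mat k C i j = (if i = k \<or> j = k then - C i j
     else C i j + max 0 (C i k) * max 0 (C k j) - max 0 (- C i k) * max 0 (- C k j))"
  by (simp add: mut_mat_def mutation_term)

lemma mut_mat_involutive: "mut_mat k (mut_mat k C) = C"
  by (intro ext) (simp add: mut_mat_alt)

lemma mut_mat_uminus: "mut_mat k (\<lambda>i j. - C i j) = (\<lambda>i j. - mut_mat k C i j)"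
  by (intro ext) (simp add: mut_mat_alt)

lemma skew_symmetrizable_uminus:
  "skew_symmetrizable n C \<Longrightarrow> skew_symmetrizable n (\<lambda>i j. - C i j)"
  unfolding skew_symmetrizable_def by fastforce

text \<open>The same weights \<open>d\<close> work: they turn the positive part of
  \<open>C i j\<close> into the negative part of \<open>C j i\<close>, so transposition exchanges
  the two correction terms.\<close>

lemma skew_symmetrizable_mut_mat:
  assumes C: "skew_symmetrizable n C" and k: "k \<in> {1..n}"
  shows "skew_symmetrizable n (mut_mat k C)"
proof -
  obtain d where d: "\<And>i. i \<in> {1..n} \<Longrightarrow> d i > (0::int)"
    and skew: "\<And>i j. i \<in> {1..n} \<Longrightarrow> j \<in> {1..n} \<Longrightarrow> d i * C i j = - (d j * C j i)"
    using C unfolding skew_symmetrizable_def by metis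
  have pos: "d i * max 0 (C i j) = d j * max 0 (- C j i)"
    and neg: "d i * max 0 (- C i j) = d j * max 0 (C j i)"
    if "i \<in> {1..n}" "j \<in> {1..n}" for i j
  proof -
    have "d i * max 0 (C i j) = max 0 (d i * C i j)" "d i * max 0 (- C i j) = max 0 (- (d i * C i j))"
      using d[OF that(1)] by (auto simp: max_def mult_le_0_iff zero_le_mult_iff)
    moreover have "d j * max 0 (- C j i) = max 0 (- (d j * C j i))" "d j * max 0 (C j i) = max 0 (d j * C j i)"
      using d[OF that(2)] by (auto simp: max_def mult_le_0_iff zero_le_mult_iff)
    ultimately show "d i * max 0 (C i j) = d j * max 0 (- C j i)"
      "d i * max 0 (- C i j) = d j * max 0 (C j i)"
      using skew[OF that] by simp_all
  qed
  have "d i * mut_mat k C i j = - (d j * mut_mat k C j i)" if "i \<in> {1..n}" "j \<in> {1..n}" for i j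
  proof (cases "i = k \<or> j = k")
    case True
    then show ?thesis using skew[OF that] by (auto simp: mut_mat_alt)
  next
    case False
    have "d i * (max 0 (C i k) * max 0 (C k j)) = max 0 (- C k i) * (d k * max 0 (C k j))"
      using pos[OF that(1) k] by (simp add: mult.assoc[symmetric])
    also have "\<dots> = d j * (max 0 (- C j k) * max 0 (- C k i))"
      using pos[OF k that(2)] by simp
    finally have 1: "d i * (max 0 (C i k) * max 0 (C k j)) = d j * (max 0 (- C j k) * max 0 (- C k i))" .
    have "d i * (max 0 (- C i k) * max 0 (- C k j)) = max 0 (C k i) * (d k * max 0 (- C k j))"
      using neg[OF that(1) k] by (simp add: mult.assoc[symmetric])
    also have "\<dots> = d j * (max 0 (C j k) * max 0 (C k i))"
      using neg[OF k that(2)] by simp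
    finally have 2: "d i * (max 0 (- C i k) * max 0 (- C k j)) = d j * (max 0 (C j k) * max 0 (C k i))" .
    show ?thesis using False 1 2 skew[OF that]
      by (simp add: mut_mat_alt distrib_left right_diff_distrib)
  qed
  then show ?thesis unfolding skew_symmetrizable_def using d by blast
qed

lemma skew_symmetrizable_sign:
  assumes "skew_symmetrizable n C" "i \<in> {1..n}" "j \<in> {1..n}"
  shows "C i j > 0 \<longleftrightarrow> C j i < 0" "C i j = 0 \<longleftrightarrow> C j i = 0"
proof -
  obtain d where d: "d i > (0::int)" "d j > 0" "d i * C i j = - (d j * C j i)"
    using assms unfolding skew_symmetrizable_def by metis
  have "C i j > 0 \<longleftrightarrow> d i * C i j > 0" "C j i < 0 \<longleftrightarrow> d j * C j i < 0"
    using d(1,2) by (simp_all add: zero_less_mult_iff mult_less_0_iff)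
  then show "C i j > 0 \<longleftrightarrow> C j i < 0" using d(3) by linarith
  show "C i j = 0 \<longleftrightarrow> C j i = 0" using d by auto
qed

lemma skew_symmetrizable_diag:
  assumes "skew_symmetrizable n C" "i \<in> {1..n}"
  shows "C i i = 0"
  using skew_symmetrizable_sign(1)[OF assms(1) assms(2) assms(2)] by linarith

definition indep_cols :: "nat \<Rightarrow> nat \<Rightarrow> (nat \<Rightarrow> nat \<Rightarrow> int) \<Rightarrow> bool" where
  "indep_cols m n C \<longleftrightarrow> (\<forall>c. (\<forall>i\<in>{1..m}. (\<Sum>j\<in>{1..n}. c j * C i j) = 0) \<longrightarrow> (\<forall>j\<in>{1..n}. c j = 0))"

text \<open>A relation \<open>c\<close> between the mutated columns pulls back to a relation
  \<open>c'\<close> between the old ones in which only the coefficient of column \<open>k\<close>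
  changes. Row \<open>k\<close> of the relation makes the sums over the positive and over the
  negative parts of that row equal, so the correction terms combine to \<open>s\<close> times column
  \<open>k\<close>.\<close>

lemma indep_cols_mut_mat:
  assumes C: "indep_cols m n C" and k: "k \<in> {1..n}" and nm: "n \<le> m" and kk: "C k k = 0"
  shows "indep_cols m n (mut_mat k C)"
  unfolding indep_cols_def
proof (intro allI impI)
  fix c assume c: "\<forall>i\<in>{1..m}. (\<Sum>j\<in>{1..n}. c j * mut_mat k C i j) = 0"
  let ?J = "{1..n} - {k}"
  define s where "s = (\<Sum>j\<in>?J. c j * max 0 (- C k j))"
  define c' where "c' = c(k := s - c k)"
  have split: "(\<Sum>j\<in>{1..n}. f j) = f k + (\<Sum>j\<in>?J. f j)" for f :: "nat \<Rightarrow> int"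
    using k by (simp add: sum.remove)
  have rowk: "(\<Sum>j\<in>?J. c j * C k j) = 0"
  proof -
    have "(\<Sum>j\<in>{1..n}. c j * mut_mat k C k j) = 0" using c k nm by auto
    then show ?thesis unfolding split using kk by (simp add: mut_mat_alt sum_negf)
  qed
  have rowk': "(\<Sum>j\<in>?J. c j * max 0 (C k j)) = s"
  proof -
    have "max 0 (C k j) = C k j + max 0 (- C k j)" for j by simp
    then have "(\<Sum>j\<in>?J. c j * max 0 (C k j)) = (\<Sum>j\<in>?J. c j * C k j + c j * max 0 (- C k j))"
      by (metis (no_types, lifting) distrib_left)
    then show ?thesis unfolding sum.distrib rowk s_def by simp
  qed
  have "(\<Sum>j\<in>{1..n}. c' j * C i j) = 0" if i: "i \<in> {1..m}" for i
  proof (cases "i = k")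
    case True
    then show ?thesis unfolding split using rowk kk by (simp add: c'_def)
  next
    case False
    have "0 = (\<Sum>j\<in>{1..n}. c j * mut_mat k C i j)" using c i by simp
    also have "\<dots> = - c k * C i k + (\<Sum>j\<in>?J. c j * C i j + max 0 (C i k) * (c j * max 0 (C k j))
        - max 0 (- C i k) * (c j * max 0 (- C k j)))"
      unfolding split using False by (auto simp: mut_mat_alt algebra_simps intro!: sum.cong)
    also have "\<dots> = - c k * C i k + (\<Sum>j\<in>?J. c j * C i j) + max 0 (C i k) * s - max 0 (- C i k) * s"
      unfolding sum.distrib sum_subtractf sum_distrib_left[symmetric] rowk' s_def[symmetric] by simp
    also have "\<dots> = - c k * C i k + (\<Sum>j\<in>?J. c j * C i j) + C i k * s"
      by (simp add: max_def algebra_simps)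
    finally show ?thesis unfolding split by (simp add: c'_def algebra_simps)
  qed
  then have c0: "c' j = 0" if "j \<in> {1..n}" for j
    using C that unfolding indep_cols_def by blast
  have cJ: "c j = 0" if "j \<in> ?J" for j using c0[of j] that by (simp add: c'_def)
  have "s = 0" unfolding s_def using cJ by simp
  then have "c k = 0" using c0[OF k] by (simp add: c'_def)
  then show "\<forall>j\<in>{1..n}. c j = 0" using cJ by (metis Diff_iff singletonD)
qed

lemma indep_cols_minor:
  assumes C: "indep_cols m n C" and ab: "a \<in> {1..n}" "b \<in> {1..n}" "a \<noteq> b"
  obtains i j where "i \<in> {1..m}" "j \<in> {1..m}" "C i a * C j b - C j a * C i b \<noteq> 0"
proof -
  have sum2: "(\<Sum>j\<in>{1..n}. (if j = a then u else if j = b then v else 0) * C i j) = u * C i a + v * C i b"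
    for u v i
  proof -
    have "(\<Sum>j\<in>{1..n}. (if j = a then u else if j = b then v else 0) * C i j)
      = (\<Sum>j\<in>{a, b}. (if j = a then u else if j = b then v else 0) * C i j)"
      by (rule sum.mono_neutral_right) (use ab in auto)
    then show ?thesis using ab by simp
  qed
  have two: "u = 0 \<and> v = 0" if "\<And>i. i \<in> {1..m} \<Longrightarrow> u * C i a + v * C i b = 0" for u v
  proof -
    have "\<forall>i\<in>{1..m}. (\<Sum>j\<in>{1..n}. (if j = a then u else if j = b then v else 0) * C i j) = 0"
      unfolding sum2 using that by blast
    then have "\<forall>j\<in>{1..n}. (if j = a then u else if j = b then v else 0) = 0"
      using C[unfolded indep_cols_def, THEN spec, of "\<lambda>j. if j = a then u else if j = b then v else 0"]
      by (rule rev_mp)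
    then show ?thesis using ab by (metis (full_types))
  qed
  obtain i where i: "i \<in> {1..m}" "C i a \<noteq> 0" using two[of 1 0] by auto
  have "\<exists>j\<in>{1..m}. C i a * C j b - C j a * C i b \<noteq> 0"
  proof (rule ccontr)
    assume "\<not> ?thesis"
    then have "- C i b * C j a + C i a * C j b = 0" if "j \<in> {1..m}" for j
      using that by (auto simp: algebra_simps)
    then show False using two[of "- C i b" "C i a"] i by auto
  qed
  then show ?thesis using that i by blast
qed

section \<open>Exponent vectors, exchange binomials and cluster mutation\<close>

definition vec :: "nat \<Rightarrow> (nat \<Rightarrow> int) \<Rightarrow> expo" where
  "vec m v = (\<Sum>i\<in>{1..m}. single i (v i))"

lemma lookup_vec: "lookup (vec m v) i = (if i \<in> {1..m} then v i else 0)"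
  by (auto simp: vec_def lookup_sum lookup_single when_def)

lemma keys_vec: "keys (vec m v) \<subseteq> {1..m}"
  by (auto simp: in_keys_iff lookup_vec split: if_splits)

abbreviation posv :: "nat \<Rightarrow> (nat \<Rightarrow> nat \<Rightarrow> int) \<Rightarrow> nat \<Rightarrow> expo" where
  "posv m C k \<equiv> vec m (\<lambda>i. max 0 (C i k))"

abbreviation negv :: "nat \<Rightarrow> (nat \<Rightarrow> nat \<Rightarrow> int) \<Rightarrow> nat \<Rightarrow> expo" where
  "negv m C k \<equiv> vec m (\<lambda>i. max 0 (- C i k))"

definition binom :: "nat \<Rightarrow> (nat \<Rightarrow> nat \<Rightarrow> int) \<Rightarrow> nat \<Rightarrow> 'c::comm_ring_1 laurent" where
  "binom m C k = single (posv m C k) 1 + single (negv m C k) 1"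

definition exch :: "nat \<Rightarrow> nat \<Rightarrow> (nat \<Rightarrow> 'f::field) \<Rightarrow> (nat \<Rightarrow> nat \<Rightarrow> int) \<Rightarrow> 'f" where
  "exch m k y C = mon y (posv m C k) + mon y (negv m C k)"

lemma (in coef_hom) lev_binom: "lev y (binom m C k) = exch m k y C"
  by (simp add: binom_def exch_def lev_add)

lemma mon_posv: "mon y (posv m C k) = (\<Prod>i\<in>{i\<in>{1..m}. C i k > 0}. y i ^ nat (C i k))"
proof -
  have "mon y (posv m C k) = (\<Prod>i\<in>{i\<in>{1..m}. C i k > 0}. y i powi lookup (posv m C k) i)"
    by (rule mon_superset) (auto simp: in_keys_iff lookup_vec split: if_splits)
  also have "\<dots> = (\<Prod>i\<in>{i\<in>{1..m}. C i k > 0}. y i ^ nat (C i k))"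
    by (intro prod.cong HOL.refl) (auto simp: lookup_vec power_int_def)
  finally show ?thesis .
qed

lemma mut_clu_exch: "mut_clu m k y C = y(k := inverse (y k) * exch m k y C)"
  using mon_posv[of y m C k] mon_posv[of y m "\<lambda>i j. - C i j" k]
  by (simp add: mut_clu_def exch_def)

lemma exch_uminus: "exch m k y (\<lambda>i j. - C i j) = exch m k y C"
  by (simp add: exch_def add.commute)

lemma mut_clu_uminus: "mut_clu m k y (\<lambda>i j. - C i j) = mut_clu m k y C"
  by (simp add: mut_clu_exch exch_uminus)

lemma exch_upd:
  assumes "C j k = 0"
  shows "exch m k (y(j := v)) C = exch m k y C"
  unfolding exch_def by (subst (1 2) mon_upd) (auto simp: lookup_vec assms)

lemma exch_cong: "(\<And>i. i \<in> {1..m} \<Longrightarrow> C i k = C' i k) \<Longrightarrow> exch m k y C = exch m k y C'"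
  unfolding exch_def vec_def by simp

text \<open>Mutation negates column \<open>k\<close>, which only swaps the two monomials, and
  \<open>y k\<close> occurs in neither because \<open>C k k = 0\<close>.\<close>

lemma exch_mut_mat:
  assumes "C k k = 0"
  shows "exch m k (y(k := v)) (mut_mat k C) = exch m k y C"
proof -
  have "exch m k (y(k := v)) (mut_mat k C) = exch m k y (mut_mat k C)"
    by (rule exch_upd) (simp add: mut_mat_def assms)
  also have "\<dots> = exch m k y (\<lambda>i j. - C i j)"
    by (rule exch_cong) (simp add: mut_mat_def)
  finally show ?thesis by (simp add: exch_uminus)
qed

lemma mut_clu_involutive:
  assumes "C k k = 0" "y k \<noteq> 0" "mut_clu m k y C k \<noteq> 0"
  shows "mut_clu m k (mut_clu m k y C) (mut_mat k C) = y"
  using assms exch_mut_mat[of C k m y] by (auto simp: mut_clu_exch)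

lemma mut_equiv_trans:
  "(z, D) \<in> mut_equiv m n y C \<Longrightarrow> (y, C) \<in> mut_equiv m n x B \<Longrightarrow> (z, D) \<in> mut_equiv m n x B"
  by (induction rule: mut_equiv.induct) (auto intro: mut_equiv.step)

text \<open>If both exponents coincide, the coefficient is 2, which is nonzero in characteristic
  0.\<close>

lemma binom_neq_0: "binom m C k \<noteq> (0 :: 'c::{comm_ring_1,ring_char_0} laurent)"
proof
  assume 0: "binom m C k = (0 :: 'c laurent)"
  have "lookup (binom m C k) (posv m C k) = (1::'c) \<or> lookup (binom m C k) (posv m C k) = (2::'c)"
    by (auto simp: binom_def lookup_add lookup_single when_def)
  then show False unfolding 0 by simp
qed

lemma keys_binom: "keys (binom m C k) \<subseteq> {posv m C k, negv m C k}"
  unfolding binom_def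
  using Poly_Mapping.keys_add[of "single (posv m C k) 1" "single (negv m C k) 1"] by auto

lemma homogeneous_binom:
  assumes "l (posv m C k) = a" "l (negv m C k) = a"
  shows "homogeneous l a (binom m C k)"
  using keys_binom[of m C k] assms by (auto simp: homogeneous_def)

lemma homogeneous_binom_diag:
  assumes "C k k = 0"
  shows "homogeneous (\<lambda>e. lookup e k) 0 (binom m C k)"
  by (rule homogeneous_binom) (simp_all add: lookup_vec assms)

locale coef_hom_0 = coef_hom \<kappa> for \<kappa> :: "'c::{idom,ring_char_0} \<Rightarrow> 'f::field"
begin

text \<open>Algebraic independence restated for Laurent polynomials. Nonzero entries are demanded at
  all indices, because multiplicativity of \<open>mon\<close> fails at 0.\<close>

definition lindep :: "'c set \<Rightarrow> nat set \<Rightarrow> (nat \<Rightarrow> 'f) \<Rightarrow> bool" where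
  "lindep K V y \<longleftrightarrow> 0 \<notin> range y \<and> (\<forall>p\<in>lring K (supp_in V). lev y p = 0 \<longrightarrow> p = 0)"

lemma lindep_inj:
  assumes "lindep UNIV UNIV y" "lev y p = lev y q"
  shows "p = q"
proof -
  have "lev y (p - q) = 0" using assms(2) by (simp add: lev_diff)
  then have "p - q = 0" using assms(1) unfolding lindep_def supp_in_UNIV lring_UNIV by blast
  then show ?thesis by simp
qed

lemma binom_in_lring:
  assumes "subring_set K" "{1..m} \<subseteq> V"
  shows "binom m C k \<in> lring K (supp_in V)"
proof -
  interpret laurent_ring K "supp_in V"
    by unfold_locales (use assms submonoid_supp_in in auto)
  show ?thesis unfolding binom_def
    by (intro lring_add lring_single_1) (use assms(2) keys_vec in \<open>auto simp: supp_in_def\<close>)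
qed

lemma lindep_mut_clu:
  assumes K: "subring_set K" and V: "{1..m} \<subseteq> V" and y: "lindep K V y" and "C k k = 0"
  shows "lindep K V (mut_clu m k y C)"
proof -
  let ?q = "binom m C k :: 'c laurent"
  have y': "mut_clu m k y C = y(k := inverse (y k) * lev y ?q)"
    by (simp add: mut_clu_exch lev_binom)
  have q: "?q \<in> lring K (supp_in V)" by (rule binom_in_lring[OF K V])
  have "lev y ?q \<noteq> 0" using y q binom_neq_0[of m C k] unfolding lindep_def by blast
  moreover have nz: "0 \<notin> range y" using y by (simp add: lindep_def)
  ultimately have "0 \<notin> range (mut_clu m k y C)"
    unfolding y' using nonzero_at[OF nz] by (auto split: if_splits)
  moreover have "p = 0" if "p \<in> lring K (supp_in V)" "lev (mut_clu m k y C) p = 0" for p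
    by (rule exchange_preserves_indep[OF K nz _ q binom_neq_0 homogeneous_binom_diag y' that])
      (use y assms(4) in \<open>auto simp: lindep_def\<close>)
  ultimately show ?thesis by (auto simp: lindep_def)
qed

subsection \<open>Laurent rings of adjacent clusters\<close>

definition LL :: "(nat \<Rightarrow> 'f) \<Rightarrow> 'f set" where
  "LL y = range (lev y)"

lemma LL_lev: "lev y p \<in> LL y"
  by (simp add: LL_def)

lemma LL_mon: "mon y e \<in> LL y"
  using LL_lev[of y "single e 1"] by simp

lemma LL_var: "y i \<in> LL y"
  using LL_mon[of y "single i 1"] by simp

lemma LL_0: "0 \<in> LL y"
  using LL_lev[of y 0] by simp

lemma LL_1: "1 \<in> LL y"
  using LL_lev[of y 1] by simp

lemma LL_add: "f \<in> LL y \<Longrightarrow> g \<in> LL y \<Longrightarrow> f + g \<in> LL y"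
  by (auto simp: LL_def lev_add[symmetric])

text \<open>For nonzero \<open>q\<close> this is the localisation of \<open>LL z\<close> at the
  powers of \<open>q\<close>.\<close>

definition clear :: "(nat \<Rightarrow> 'f) \<Rightarrow> 'f \<Rightarrow> 'f set" where
  "clear z q = {f. \<exists>N. f * q ^ N \<in> LL z}"

context
  fixes z :: "nat \<Rightarrow> 'f"
  assumes z: "0 \<notin> range z"
begin

lemma LL_mult: "f \<in> LL z \<Longrightarrow> g \<in> LL z \<Longrightarrow> f * g \<in> LL z"
  by (auto simp: LL_def lev_mult[OF z, symmetric])

lemma LL_power: "f \<in> LL z \<Longrightarrow> f ^ n \<in> LL z"
  by (induction n) (auto simp: LL_1 LL_mult)

lemma LL_of_nat: "of_nat n \<in> LL z"
  by (induction n) (auto simp: LL_0 LL_1 LL_add)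

lemma LL_inverse_var: "inverse (z i) \<in> LL z"
  using LL_mon[of z "- single i 1"] by (simp add: mon_uminus[OF z])

lemma LL_imp_clear: "f \<in> LL z \<Longrightarrow> f \<in> clear z q"
  unfolding clear_def by (auto intro: exI[of _ 0])

lemma clear_add:
  assumes "q \<in> LL z" "f \<in> clear z q" "g \<in> clear z q"
  shows "f + g \<in> clear z q"
proof -
  obtain N M where N: "f * q ^ N \<in> LL z" "g * q ^ M \<in> LL z"
    using assms unfolding clear_def by blast
  have "(f + g) * q ^ (N + M) = f * q ^ N * q ^ M + g * q ^ M * q ^ N"
    by (simp add: power_add algebra_simps)
  also have "\<dots> \<in> LL z" by (rule LL_add[OF LL_mult[OF N(1) LL_power] LL_mult[OF N(2) LL_power]]) (rule assms)+
  finally show ?thesis unfolding clear_def by blast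
qed

lemma clear_mult:
  assumes "f \<in> clear z q" "g \<in> clear z q"
  shows "f * g \<in> clear z q"
proof -
  obtain N M where N: "f * q ^ N \<in> LL z" "g * q ^ M \<in> LL z"
    using assms unfolding clear_def by blast
  have "(f * g) * q ^ (N + M) = (f * q ^ N) * (g * q ^ M)"
    by (simp add: power_add algebra_simps)
  also have "\<dots> \<in> LL z" by (rule LL_mult[OF N])
  finally show ?thesis unfolding clear_def by blast
qed

lemma clear_power: "f \<in> clear z q \<Longrightarrow> f ^ n \<in> clear z q"
  by (induction n) (auto intro: clear_mult LL_imp_clear LL_1)

lemma LL_subset_clear:
  assumes q: "q \<in> LL z" and w: "\<And>i. w i \<in> clear z q" "\<And>i. inverse (w i) \<in> clear z q"
  shows "LL w \<subseteq> clear z q"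
proof -
  have powi: "w i powi a \<in> clear z q" for i a
    using w clear_power by (auto simp: power_int_def)
  have prod: "prod f S \<in> clear z q" if "\<And>i. f i \<in> clear z q" for f :: "nat \<Rightarrow> 'f" and S
    by (induction S rule: infinite_finite_induct) (auto simp: that clear_mult LL_imp_clear LL_1)
  have "lev w p \<in> clear z q" for p
  proof (induction p rule: poly_mapping_single_induct)
    case (single e c)
    have "\<kappa> c \<in> LL z" using LL_lev[of z "single 0 c"] by (simp add: lev_single)
    moreover have "mon w e \<in> clear z q" unfolding mon_def by (intro prod powi)
    ultimately show ?case unfolding lev_single using clear_mult LL_imp_clear by blast
  qed (auto simp: lev_add q clear_add LL_imp_clear LL_0)
  then show ?thesis by (auto simp: LL_def)
qed

text \<open>The only new denominator comes from the inverse of \<open>q / z k\<close>, which is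
  \<open>z k / q\<close>.\<close>

lemma clear_upd:
  assumes q: "q \<in> LL z" "q \<noteq> 0" and w: "w = z(k := q / z k)"
  shows "LL w \<subseteq> clear z q"
proof (rule LL_subset_clear[OF q(1)])
  fix i
  have "q / z k \<in> LL z" using LL_mult[OF q(1) LL_inverse_var] by (simp add: divide_inverse)
  then show "w i \<in> clear z q" unfolding w by (auto intro: LL_imp_clear LL_var)
  have "inverse (q / z k) * q ^ 1 = z k" using q(2) by (simp add: field_simps)
  then have "inverse (q / z k) * q ^ 1 \<in> LL z" by (simp only: LL_var)
  then have "inverse (q / z k) \<in> clear z q" unfolding clear_def by blast
  then show "inverse (w i) \<in> clear z q" unfolding w by (auto intro: LL_imp_clear LL_inverse_var)
qed

end

text \<open>Comparing the two representations gives \<open>p ^ N * b = q ^ M * a\<close>. As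
  \<open>q\<close> is a nonzerodivisor modulo \<open>p\<close>, the power \<open>p ^ N\<close>
  divides \<open>a\<close>, and the denominator disappears.\<close>

lemma clear_inter:
  assumes z: "lindep UNIV UNIV z" and pq: "p \<noteq> 0" "nzd_mod p q"
    and f: "f \<in> clear z (lev z p)" "f \<in> clear z (lev z q)"
  shows "f \<in> LL z"
proof -
  have nz: "0 \<notin> range z" using z by (simp add: lindep_def)
  obtain N M a b where a: "f * lev z p ^ N = lev z a" and b: "f * lev z q ^ M = lev z b"
    using f by (auto simp: clear_def LL_def)
  have "lev z (p ^ N * b) = lev z (q ^ M * a)"
    by (simp add: lev_mult[OF nz] lev_power[OF nz] a[symmetric] b[symmetric])
  then have "p ^ N * b = q ^ M * a" by (rule lindep_inj[OF z])
  moreover have "nzd_mod (p ^ N) (q ^ M)" using pq by (intro nzd_mod_power nzd_mod_power_left)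
  ultimately obtain r where r: "a = p ^ N * r" unfolding nzd_mod_def by (metis dvdE dvd_triv_left)
  have "lev z p \<noteq> 0" using lindep_inj[OF z, of p 0] pq(1) by auto
  moreover have "f * lev z p ^ N = lev z p ^ N * lev z r"
    unfolding a r by (simp add: lev_mult[OF nz] lev_power[OF nz])
  ultimately have "f = lev z r" by simp
  then show ?thesis by (simp add: LL_lev)
qed

end

section \<open>Two mutation directions\<close>

context coef_hom_0
begin

text \<open>The linear term has to be explicit: it survives modulo the exchange polynomial in
  \<open>adjacent_noncommuting\<close> when \<open>C j k = - 1\<close>.\<close>

lemma expand_power:
  assumes z: "0 \<notin> range z" and us: "u \<in> LL z" "s \<in> LL z"
  shows "\<exists>r\<in>LL z. (u + s) ^ Suc c = u ^ Suc c + of_nat (Suc c) * u ^ c * s + s ^ 2 * r"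
proof (induction c)
  case 0
  show ?case using LL_0 by (intro bexI[of _ 0]) auto
next
  case (Suc c)
  then obtain r where r: "r \<in> LL z"
    "(u + s) ^ Suc c = u ^ Suc c + of_nat (Suc c) * u ^ c * s + s ^ 2 * r" by blast
  have "(u + s) ^ Suc (Suc c) = (u + s) * (u ^ Suc c + of_nat (Suc c) * u ^ c * s + s ^ 2 * r)"
    unfolding r(2)[symmetric] by simp
  also have "\<dots> = u ^ Suc (Suc c) + of_nat (Suc (Suc c)) * u ^ Suc c * s
      + s ^ 2 * (of_nat (Suc c) * u ^ c + (u + s) * r)"
    by (simp add: algebra_simps power2_eq_square)
  finally have "(u + s) ^ Suc (Suc c) = u ^ Suc (Suc c) + of_nat (Suc (Suc c)) * u ^ Suc c * s
      + s ^ 2 * (of_nat (Suc c) * u ^ c + (u + s) * r)" .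
  moreover have "of_nat (Suc c) * u ^ c + (u + s) * r \<in> LL z"
    by (intro LL_add LL_mult[OF z] LL_power[OF z] LL_of_nat[OF z] us r)
  ultimately show ?case by blast
qed

text \<open>Neither mutation affects the exchange polynomial of the other, so \<open>z\<close>
  differs from each of the two neighbours of \<open>y\<close> in one entry only. Over
  \<open>z\<close>, the element \<open>f\<close> can be written with a power of \<open>P2\<close> as
  denominator and also with a power of \<open>P1\<close>.\<close>

lemma adjacent_commuting:
  assumes y: "lindep UNIV UNIV y" and C: "skew_symmetrizable n C" "indep_cols m n C"
    and kj: "k \<in> {1..n}" "j \<in> {1..n}" "k \<noteq> j" and 0: "C k j = 0"
    and f: "f \<in> LL (mut_clu m k y C)" "f \<in> LL (mut_clu m j y C)"
  shows "f \<in> LL (mut_clu m j (mut_clu m k y C) (mut_mat k C))"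
proof -
  define P1 where "P1 = exch m k y C"
  define P2 where "P2 = exch m j y C"
  define z where "z = y(k := inverse (y k) * P1, j := inverse (y j) * P2)"
  have C0: "C j k = 0" "C k k = 0" "C j j = 0"
    using skew_symmetrizable_sign(2)[OF C(1) kj(1,2)] 0 skew_symmetrizable_diag[OF C(1)] kj by auto
  have "exch m j (y(k := inverse (y k) * P1)) (mut_mat k C) = exch m j (y(k := inverse (y k) * P1)) C"
    by (rule exch_cong) (use 0 kj in \<open>auto simp: mut_mat_alt\<close>)
  also have "\<dots> = P2" unfolding P2_def by (rule exch_upd[of C k j, OF 0])
  finally have z: "mut_clu m j (mut_clu m k y C) (mut_mat k C) = z"
    using kj by (simp add: mut_clu_exch z_def P1_def)
  have y': "mut_clu m k y C = y(k := inverse (y k) * P1)" "mut_clu m j y C = y(j := inverse (y j) * P2)"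
    by (simp_all add: mut_clu_exch P1_def P2_def)
  have "lindep UNIV UNIV (mut_clu m j (mut_clu m k y C) (mut_mat k C))"
    by (intro lindep_mut_clu y) (auto simp: subring_set_def C0 mut_mat_def 0)
  then have lz: "lindep UNIV UNIV z" by (simp add: z)
  then have nz: "0 \<notin> range z" by (simp add: lindep_def)
  have P: "P1 = lev z (binom m C k)" "P2 = lev z (binom m C j)"
    unfolding lev_binom P1_def P2_def z_def by (simp_all add: exch_upd C0 0)
  have nP: "P1 \<noteq> 0" "P2 \<noteq> 0" using nonzero_at[OF nz, of k] nonzero_at[OF nz, of j] kj
    by (auto simp: z_def)
  have ny: "y i \<noteq> 0" for i using y by (intro nonzero_at) (simp add: lindep_def)
  have PL: "P1 \<in> LL z" "P2 \<in> LL z" unfolding P by (rule LL_lev)+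
  have "LL (mut_clu m k y C) \<subseteq> clear z P2"
    by (rule clear_upd[OF nz PL(2) nP(2), where k = j]) (use nP kj ny in \<open>auto simp: y' z_def fun_eq_iff field_simps\<close>)
  moreover have "LL (mut_clu m j y C) \<subseteq> clear z P1"
    by (rule clear_upd[OF nz PL(1) nP(1), where k = k]) (use nP kj ny in \<open>auto simp: y' z_def fun_eq_iff field_simps\<close>)
  moreover obtain a b where ab: "a \<in> {1..m}" "b \<in> {1..m}" "C a j * C b k - C b j * C a k \<noteq> 0"
    using indep_cols_minor[OF C(2) kj(2) kj(1)] kj(3) by metis
  \<comment> \<open>The determinant with column \<open>j\<close> in rows \<open>a\<close> and
    \<open>b\<close>. It vanishes on column \<open>j\<close>, which makes \<open>binom m C j\<close>
    homogeneous; on column \<open>k\<close> it is the nonzero minor, which separates the monomials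
    of \<open>binom m C k\<close>.\<close>
  define l where "l = (\<lambda>e::expo. C a j * lookup e b - C b j * lookup e a)"
  interpret grading l by unfold_locales (simp add: l_def lookup_add algebra_simps)
  have col: "l (posv m C i) - l (negv m C i) = C a j * C b i - C b j * C a i" for i
    using ab by (simp add: l_def lookup_vec max_def algebra_simps)
  have "nzd_mod (binom m C j) (binom m C k :: 'c laurent)"
    unfolding binom_def[of m C k]
    by (rule nzd_mod_binomial[OF homogeneous_binom[OF _ HOL.refl]])
      (use col[of j] col[of k] ab(3) in \<open>auto simp: mult.commute\<close>)
  ultimately show ?thesis
    unfolding z using f by (intro clear_inter[OF lz binom_neq_0]) (auto simp: P)
qed

text \<open>Everything is written in the cluster \<open>z\<close>, where
  \<open>y j = p2 / z j\<close> vanishes modulo \<open>p2\<close>. Dropping \<open>y j\<close>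
  leaves of \<open>P1\<close> a monomial, and of \<open>w j\<close> a monomial or a binomial with
  distinct degrees in \<open>z j\<close>. So \<open>P1 * w j\<close>, whose powers are the
  denominators of \<open>LL w\<close>, is a nonzerodivisor modulo \<open>p2\<close>, whose powers
  are the denominators of \<open>LL y'\<close>.\<close>

lemma adjacent_noncommuting:
  assumes y: "lindep UNIV UNIV y" and C: "skew_symmetrizable n C" and nm: "n \<le> m"
    and kj: "k \<in> {1..n}" "j \<in> {1..n}" "k \<noteq> j" and pos: "C k j > 0"
    and f: "f \<in> LL (mut_clu m k y C)" "f \<in> LL (mut_clu m j y C)"
  shows "f \<in> LL (mut_clu m j (mut_clu m k y C) (mut_mat k C))"
proof -
  define C' where "C' = mut_mat k C"
  define P1 where "P1 = exch m k y C"
  define P2 where "P2 = exch m j y C"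
  define y' where "y' = y(k := inverse (y k) * P1)"
  define P2' where "P2' = exch m j y' C'"
  define z where "z = y'(j := inverse (y j) * P2')"
  define w where "w = y(j := inverse (y j) * P2)"
  have kjm: "k \<in> {1..m}" "j \<in> {1..m}" using kj nm by auto
  have C0: "C k k = 0" "C j j = 0" "C' j j = 0" "C' k k = 0"
    using skew_symmetrizable_diag[OF C] skew_symmetrizable_diag[OF skew_symmetrizable_mut_mat[OF C kj(1)]] kj
    by (auto simp: C'_def)
  \<comment> \<open>With \<open>C k j = c + 1\<close> and \<open>C j k = - (b + 1)\<close>, one
    factor \<open>y j\<close> can be split off in natural powers.\<close>
  define c where "c = nat (C k j - 1)"
  have c: "C k j = int (Suc c)" using pos by (simp add: c_def)
  define b where "b = nat (- C j k - 1)"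
  have b: "C j k = - int (Suc b)"
    using skew_symmetrizable_sign(1)[OF C kj(1,2)] pos by (simp add: b_def)
  have z_eq: "mut_clu m j (mut_clu m k y C) (mut_mat k C) = z"
    using kj by (simp add: mut_clu_exch z_def y'_def P1_def P2'_def C'_def)
  have y'_eq: "mut_clu m k y C = y'" and w_eq: "mut_clu m j y C = w"
    by (simp_all add: mut_clu_exch P1_def P2_def y'_def w_def)
  have lz: "lindep UNIV UNIV z" unfolding z_eq[symmetric]
    by (intro lindep_mut_clu y) (use C0 in \<open>auto simp: subring_set_def C'_def\<close>)
  then have nz: "0 \<notin> range z" by (simp add: lindep_def)
  have ny: "0 \<notin> range y" using y by (simp add: lindep_def)
  have zi: "z i \<noteq> 0" for i by (rule nonzero_at[OF nz])
  have yi: "y i \<noteq> 0" for i by (rule nonzero_at[OF ny])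
  have P0: "P1 \<noteq> 0" "P2' \<noteq> 0" using zi[of k] zi[of j] kj by (auto simp: z_def y'_def)
  have zk: "z k = P1 / y k" and zj: "z j = P2' / y j"
    using kj by (simp_all add: z_def y'_def divide_inverse mult.commute)
  have yk: "y k = P1 / z k" and yj: "y j = P2' / z j"
    unfolding zk zj using P0 yi by simp_all
  have mon_z: "mon z e = mon y e" if "lookup e k = 0" "lookup e j = 0" for e
    unfolding z_def y'_def by (simp add: mon_upd that)
  define p2 where "p2 = (binom m C' j :: 'c laurent)"
  have P2'z: "P2' = lev z p2"
    unfolding p2_def lev_binom P2'_def z_def by (simp add: exch_upd C0)
  define Yj where "Yj = p2 * single (- single j 1) 1"
  have Yj: "y j = lev z Yj"
    unfolding yj Yj_def lev_mult[OF nz] P2'z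
    by (simp add: mon_uminus[OF nz] divide_inverse)
  have yjL: "y j \<in> LL z" unfolding Yj by (rule LL_lev)

  \<comment> \<open>Both exponents avoid the directions \<open>k\<close> and \<open>j\<close>, so
    their monomials agree in \<open>y\<close> and \<open>z\<close>. In \<nu> the factor
    \<open>y j ^ Suc b\<close> of the negative monomial has been removed.\<close>
  define \<upsilon> where "\<upsilon> = posv m C k"
  define \<nu> where "\<nu> = negv m C k - single j (int (Suc b))"
  have \<upsilon>0: "lookup \<upsilon> k = 0" "lookup \<upsilon> j = 0" and \<nu>0: "lookup \<nu> k = 0" "lookup \<nu> j = 0"
    using kj kjm C0 b by (auto simp: \<upsilon>_def \<nu>_def lookup_vec lookup_minus lookup_single when_def)
  define s where "s = mon z \<nu> * y j ^ Suc b"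
  have P1: "P1 = mon z \<upsilon> + s"
  proof -
    have "mon y (negv m C k) = mon y (\<nu> + single j (int (Suc b)))" by (simp add: \<nu>_def)
    also have "\<dots> = mon y \<nu> * y j ^ Suc b"
      unfolding mon_add[OF ny] mon_single by (simp only: power_int_of_nat)
    finally show ?thesis
      by (simp add: P1_def exch_def s_def mon_z[OF \<nu>0] mon_z[OF \<upsilon>0]) (simp add: \<upsilon>_def)
  qed
  have sL: "s \<in> LL z" unfolding s_def by (intro LL_mult[OF nz] LL_power[OF nz] LL_mon yjL)
  obtain r where r: "r \<in> LL z" and P1c: "P1 ^ Suc c = mon z \<upsilon> ^ Suc c
      + of_nat (Suc c) * mon z \<upsilon> ^ c * s + s ^ 2 * r"
    unfolding P1 using expand_power[OF nz LL_mon sL] by blast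

  define \<alpha> where "\<alpha> = posv m C j - single k (int (Suc c))"
  have \<alpha>0: "lookup \<alpha> k = 0" "lookup \<alpha> j = 0"
    using kj kjm C0 c by (auto simp: \<alpha>_def lookup_vec lookup_minus lookup_single when_def)
  have neg0: "lookup (negv m C j) k = 0" "lookup (negv m C j) j = 0"
    using kj kjm C0 c by (auto simp: lookup_vec)
  \<comment> \<open>The second subtraction accounts for the denominator in
    \<open>y k ^ Suc c = (P1 / z k) ^ Suc c\<close>.\<close>
  define \<beta> where "\<beta> = \<alpha> - single k (int (Suc c))"
  have mon_\<beta>: "mon z \<beta> = mon z \<alpha> / z k ^ Suc c"
    unfolding \<beta>_def mon_diff[OF nz] mon_single by (simp only: power_int_of_nat)
  have P2: "P2 = mon z \<beta> * P1 ^ Suc c + mon z (negv m C j)"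
  proof -
    have "mon y (posv m C j) = mon y (\<alpha> + single k (int (Suc c)))" by (simp add: \<alpha>_def)
    also have "\<dots> = mon y \<alpha> * y k ^ Suc c"
      unfolding mon_add[OF ny] mon_single by (simp only: power_int_of_nat)
    also have "\<dots> = mon z \<beta> * P1 ^ Suc c"
      unfolding mon_\<beta> yk by (simp add: mon_z[OF \<alpha>0] power_divide)
    finally show ?thesis by (simp add: P2_def exch_def mon_z[OF neg0])
  qed
  define \<omega> where "\<omega> = negv m C j - negv m C' j"
  define \<upsilon>c where "\<upsilon>c = vec m (\<lambda>i. int (Suc c) * max 0 (C i k))"
  have mon_\<upsilon>c: "mon z \<upsilon>c = mon z \<upsilon> ^ Suc c"
    by (rule mon_smult_nat[OF nz]) (simp add: \<upsilon>c_def \<upsilon>_def lookup_vec)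
  text \<open>Mutating column \<open>j\<close> at \<open>k\<close> amounts to setting \<open>y\<^sub>j = 0\<close> in \<open>y\<^sub>k = P\<^sub>1 / z\<^sub>k\<close> inside the
    exchange polynomial of \<open>j\<close>.\<close>
  have key: "mon z \<beta> * mon z \<upsilon> ^ Suc c + mon z (negv m C j) = mon z \<omega> * P2'"
  proof -
    \<comment> \<open>After subtraction of \<open>negv m C j\<close> both sides are column
      \<open>j\<close> of the mutated matrix.\<close>
    have "\<beta> + \<upsilon>c = \<omega> + posv m C' j"
    proof (rule poly_mapping_eqI)
      fix i
      have l\<beta>: "lookup \<beta> i = lookup (posv m C j) i - (if i = k then 2 * int (Suc c) else 0)"
          by (simp only: \<beta>_def \<alpha>_def lookup_minus lookup_single when_def) auto
      show "lookup (\<beta> + \<upsilon>c) i = lookup (\<omega> + posv m C' j) i"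
      proof (cases "i \<in> {1..m}")
        case True
        have C': "C' i j = (if i = k then - C i j else C i j + int (Suc c) * max 0 (C i k))"
          using kj b c by (simp add: C'_def mut_mat_alt)
        have pm: "max 0 x - max 0 (- x) = x" for x :: int by simp
        have "lookup (\<beta> + \<upsilon>c) i - lookup (negv m C j) i = C' i j"
          using True c C0 kj pm[of "C i j"]
          by (auto simp: lookup_add l\<beta> \<upsilon>c_def lookup_vec C')
        moreover have "lookup (\<omega> + posv m C' j) i - lookup (negv m C j) i = C' i j"
          using True pm[of "C' i j"] by (simp add: lookup_add \<omega>_def lookup_minus lookup_vec)
        ultimately show ?thesis by linarith
      next
        case False
        then show ?thesis using kjm
          by (auto simp: l\<beta> \<omega>_def \<upsilon>c_def lookup_add lookup_minus lookup_vec)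
      qed
    qed
    then have 1: "mon z \<beta> * mon z \<upsilon> ^ Suc c = mon z \<omega> * mon z (posv m C' j)"
      unfolding mon_\<upsilon>c[symmetric] mon_add[OF nz, symmetric] by simp
    have 2: "mon z (negv m C j) = mon z \<omega> * mon z (negv m C' j)"
      unfolding mon_add[OF nz, symmetric] by (simp add: \<omega>_def)
    have "P2' = mon z (posv m C' j) + mon z (negv m C' j)"
      unfolding P2'z p2_def lev_binom by (simp add: exch_def)
    then show ?thesis by (simp only: 1 2 distrib_left)
  qed
  define g where "g = of_nat (Suc c) * mon z \<beta> * mon z \<upsilon> ^ c * mon z \<nu>"
  define R where "R = mon z \<beta> * mon z \<nu> ^ 2 * (y j ^ b) ^ 2 * r"
  \<comment> \<open>Division by \<open>y j\<close> leaves \<open>y j ^ b\<close> in the linear term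
    and \<open>y j ^ (2 * b + 1)\<close> in the quadratic rest, so the latter always vanishes modulo
    \<open>p2\<close>.\<close>
  have wj: "w j = mon z (\<omega> + single j 1) + g * y j ^ b + y j * R"
  proof -
    have "P2 = mon z \<omega> * P2' + y j * (g * y j ^ b + y j * R)"
    proof -
      have "P2 = (mon z \<beta> * mon z \<upsilon> ^ Suc c + mon z (negv m C j))
          + mon z \<beta> * (of_nat (Suc c) * mon z \<upsilon> ^ c * s + s ^ 2 * r)"
        unfolding P2 P1c by (simp only: algebra_simps)
      moreover have "mon z \<beta> * (of_nat (Suc c) * mon z \<upsilon> ^ c * s + s ^ 2 * r)
          = y j * (g * y j ^ b + y j * R)"
        unfolding g_def R_def s_def
        by (simp add: algebra_simps power2_eq_square power_mult_distrib)
      ultimately show ?thesis unfolding key by simp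
    qed
    moreover have "w j = P2 / y j" by (simp add: w_def divide_inverse mult.commute)
    ultimately have "w j = mon z \<omega> * z j + (g * y j ^ b + y j * R)"
      unfolding zj using yi[of j] by (simp add: field_simps)
    then show ?thesis unfolding mon_add[OF nz] by simp
  qed
  have gL: "g \<in> LL z" unfolding g_def
    by (intro LL_mult[OF nz] LL_power[OF nz] LL_mon LL_of_nat[OF nz])
  have RL: "R \<in> LL z" unfolding R_def
    by (intro LL_mult[OF nz] LL_power[OF nz] LL_mon yjL r)
  define \<upsilon>c' where "\<upsilon>c' = vec m (\<lambda>i. int c * max 0 (C i k))"
  define \<gamma> where "\<gamma> = \<beta> + \<upsilon>c' + \<nu>"
  have "mon z \<upsilon>c' = mon z \<upsilon> ^ c"
    by (rule mon_smult_nat[OF nz]) (simp add: \<upsilon>c'_def \<upsilon>_def lookup_vec)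
  then have g: "g = of_nat (Suc c) * mon z \<gamma>"
    unfolding g_def \<gamma>_def mon_add[OF nz] by (simp add: mult.assoc)
  have \<kappa>_nat: "\<kappa> (of_nat i) = of_nat i" for i by (induction i) (simp_all add: \<kappa>_0 \<kappa>_1 \<kappa>_add)
  have degs: "lookup (\<omega> + single j 1) j = 1" "lookup \<gamma> j = 0"
    using kjm kj C0 b \<alpha>0 \<nu>0
    by (auto simp: \<omega>_def \<gamma>_def \<beta>_def \<upsilon>c'_def lookup_add lookup_minus lookup_vec lookup_single when_def)
  interpret gj: grading "\<lambda>e. lookup e j" by (rule grading_lookup)
  have hp2: "homogeneous (\<lambda>e. lookup e j) 0 p2"
    unfolding p2_def by (rule homogeneous_binom_diag) (simp add: C0)
  obtain q2 where q2: "w j = lev z q2" "nzd_mod p2 q2"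
  proof (cases b)
    \<comment> \<open>Only here does the linear term survive modulo \<open>p2\<close>. It has degree
      0 in \<open>z j\<close>, the leading monomial has degree 1, and \<open>p2\<close> is
      homogeneous of degree 0.\<close>
    case 0
    obtain R' where R': "R = lev z R'" using RL by (auto simp: LL_def)
    have "w j = lev z ((single (\<omega> + single j 1) 1 + single \<gamma> (of_nat (Suc c)))
        + p2 * (single (- single j 1) 1 * R'))"
      unfolding wj 0 mult.assoc[symmetric] Yj_def[symmetric]
      by (simp add: lev_add lev_mult[OF nz] lev_single \<kappa>_nat \<kappa>_1 g R' Yj[symmetric] del: of_nat_Suc)
    moreover have "nzd_mod p2 ((single (\<omega> + single j 1) 1 + single \<gamma> (of_nat (Suc c)))
        + p2 * (single (- single j 1) 1 * R'))"
      by (intro nzd_mod_add gj.nzd_mod_binomial[OF hp2]) (simp add: degs)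
    ultimately show ?thesis using that by blast
  next
    case (Suc b')
    have "g * y j ^ b' + R \<in> LL z"
      by (intro LL_add LL_mult[OF nz] LL_power[OF nz] gL yjL RL)
    then obtain R' where R': "g * y j ^ b' + R = lev z R'" by (auto simp: LL_def)
    have "w j = mon z (\<omega> + single j 1) + y j * (g * y j ^ b' + R)"
      unfolding wj Suc by (simp add: algebra_simps)
    also have "\<dots> = lev z (single (\<omega> + single j 1) 1 + p2 * (single (- single j 1) 1 * R'))"
      unfolding mult.assoc[symmetric] Yj_def[symmetric] R'
      by (simp add: lev_add lev_mult[OF nz] Yj[symmetric])
    finally show ?thesis using that nzd_mod_add[OF nzd_mod_single] by blast
  qed
  obtain q1 where q1: "P1 = lev z q1" "nzd_mod p2 q1"
  proof -
    have "mon z \<nu> * y j ^ b \<in> LL z"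
      by (intro LL_mult[OF nz] LL_power[OF nz] yjL LL_mon)
    then obtain S' where S': "mon z \<nu> * y j ^ b = lev z S'" by (auto simp: LL_def)
    have "P1 = mon z \<upsilon> + y j * (mon z \<nu> * y j ^ b)" unfolding P1 s_def by simp
    also have "\<dots> = lev z (single \<upsilon> 1 + p2 * (single (- single j 1) 1 * S'))"
      unfolding mult.assoc[symmetric] Yj_def[symmetric] S'[unfolded mult.assoc[symmetric]]
      by (simp add: lev_add lev_mult[OF nz] Yj[symmetric] S'[symmetric])
    finally show ?thesis using that nzd_mod_add[OF nzd_mod_single] by blast
  qed
  have "LL y' \<subseteq> clear z (lev z p2)"
  proof (rule clear_upd[OF nz, of _ _ j])
    show "y' = z(j := lev z p2 / z j)"
      using kj unfolding P2'z[symmetric] yj[symmetric] by (auto simp: z_def y'_def)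
  qed (use P0 P2'z LL_lev in auto)
  moreover have "LL w \<subseteq> clear z (lev z (q1 * q2))"
  proof (rule LL_subset_clear[OF nz LL_lev])
    have w0: "w j \<noteq> 0"
      using lindep_mut_clu[where K = UNIV and V = UNIV and m = m and k = j and C = C, OF _ _ y C0(2)]
      unfolding w_eq by (auto simp: subring_set_def lindep_def dest: nonzero_at)
    have wk: "w k = P1 * inverse (z k)" using yk kj by (simp add: w_def divide_inverse)
    have P1L: "P1 \<in> LL z" and wjL: "w j \<in> LL z" unfolding q1 q2 by (rule LL_lev)+
    have q12: "lev z (q1 * q2) = P1 * w j" by (simp add: lev_mult[OF nz] q1 q2)
    have other: "w i = z i" if "i \<noteq> k" "i \<noteq> j" for i using that by (simp add: w_def z_def y'_def)
    fix i
    show "w i \<in> clear z (lev z (q1 * q2))"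
    proof (cases "i = k \<or> i = j")
      case True
      then show ?thesis using wjL LL_mult[OF nz P1L LL_inverse_var[OF nz]]
        by (auto simp: wk intro!: LL_imp_clear[OF nz])
    next
      case False
      then show ?thesis by (simp add: other LL_imp_clear[OF nz] LL_var)
    qed
    have "inverse (w k) * (P1 * w j) ^ 1 = z k * w j" unfolding wk using P0 by simp
    moreover have "z k * w j \<in> LL z" by (intro LL_mult[OF nz] LL_var wjL)
    moreover have "inverse (w j) * (P1 * w j) ^ 1 = P1" using w0 by simp
    ultimately have "inverse (w k) * (P1 * w j) ^ 1 \<in> LL z" "inverse (w j) * (P1 * w j) ^ 1 \<in> LL z"
      using P1L by (simp_all only:)
    then have "inverse (w k) \<in> clear z (P1 * w j)" "inverse (w j) \<in> clear z (P1 * w j)"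
      unfolding clear_def by blast+
    then show "inverse (w i) \<in> clear z (lev z (q1 * q2))"
      using other[of i] LL_imp_clear[OF nz LL_inverse_var[OF nz, of i], of "P1 * w j"] unfolding q12
      by (cases "i = k \<or> i = j") auto
  qed
  moreover have "nzd_mod p2 (q1 * q2)" by (intro nzd_mod_mult q1 q2)
  moreover have "p2 \<noteq> 0" unfolding p2_def by (rule binom_neq_0)
  ultimately show ?thesis
    unfolding z_eq using f[unfolded y'_eq w_eq] by (intro clear_inter[OF lz, of p2 "q1 * q2"]) auto
qed

end

subsection \<open>The Laurent phenomenon for full rank exchange matrices\<close>

context coef_hom_0
begin

definition good_seed :: "nat \<Rightarrow> nat \<Rightarrow> (nat \<Rightarrow> 'f) \<Rightarrow> (nat \<Rightarrow> nat \<Rightarrow> int) \<Rightarrow> bool" where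
  "good_seed m n y C \<longleftrightarrow> lindep UNIV UNIV y \<and> skew_symmetrizable n C \<and> indep_cols m n C"

lemma good_seed_mutation:
  assumes "good_seed m n y C" "n \<le> m" "k \<in> {1..n}"
  shows "good_seed m n (mut_clu m k y C) (mut_mat k C)"
    and "mut_clu m k (mut_clu m k y C) (mut_mat k C) = y"
proof -
  have y: "lindep UNIV UNIV y" and C: "skew_symmetrizable n C" and I: "indep_cols m n C"
    using assms(1) by (auto simp: good_seed_def)
  have kk: "C k k = 0" by (rule skew_symmetrizable_diag[OF C assms(3)])
  have l: "lindep UNIV UNIV (mut_clu m k y C)"
    by (rule lindep_mut_clu) (auto simp: y kk subring_set_def)
  then show "good_seed m n (mut_clu m k y C) (mut_mat k C)"
    using skew_symmetrizable_mut_mat[OF C assms(3)] indep_cols_mut_mat[OF I assms(3,2) kk]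
    by (simp add: good_seed_def)
  have "y k \<noteq> 0" "mut_clu m k y C k \<noteq> 0"
    by (rule nonzero_at, use y l in \<open>simp add: lindep_def\<close>)+
  then show "mut_clu m k (mut_clu m k y C) (mut_mat k C) = y"
    by (rule mut_clu_involutive[where C = C, OF kk])
qed

lemma upper_bound_step:
  assumes g: "good_seed m n y C" and nm: "n \<le> m" and k: "k \<in> {1..n}" and j: "j \<in> {1..n}"
    and f: "f \<in> LL y" "\<And>j. j \<in> {1..n} \<Longrightarrow> f \<in> LL (mut_clu m j y C)"
  shows "f \<in> LL (mut_clu m j (mut_clu m k y C) (mut_mat k C))"
proof -
  have y: "lindep UNIV UNIV y" and C: "skew_symmetrizable n C" and I: "indep_cols m n C"
    using g by (auto simp: good_seed_def)
  consider "j = k" | "k \<noteq> j" "C k j = 0" | "k \<noteq> j" "C k j > 0" | "k \<noteq> j" "C k j < 0" by linarith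
  then show ?thesis
  proof cases
    case 1
    then show ?thesis using good_seed_mutation(2)[OF g nm k] f by simp
  next
    case 2
    show ?thesis by (rule adjacent_commuting[OF y C I k j 2 f(2)[OF k] f(2)[OF j]])
  next
    case 3
    show ?thesis by (rule adjacent_noncommuting[OF y C nm k j 3 f(2)[OF k] f(2)[OF j]])
  next
    case 4
    \<comment> \<open>Negating the matrix swaps the monomials of every exchange polynomial, changes
      no cluster, and makes the entry positive.\<close>
    let ?C = "\<lambda>i j. - C i j"
    have "?C k j > 0" using 4 by simp
    then have "f \<in> LL (mut_clu m j (mut_clu m k y ?C) (mut_mat k ?C))"
      by (rule adjacent_noncommuting[where C = ?C, OF y skew_symmetrizable_uminus[OF C] nm k j 4(1)])
        (use f(2) k j in \<open>simp_all add: mut_clu_uminus\<close>)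
    then show ?thesis by (simp add: mut_clu_uminus mut_mat_uminus)
  qed
qed

definition upper_bound :: "nat \<Rightarrow> nat \<Rightarrow> (nat \<Rightarrow> 'f) \<Rightarrow> (nat \<Rightarrow> nat \<Rightarrow> int) \<Rightarrow> 'f set" where
  "upper_bound m n y C = LL y \<inter> (\<Inter>j\<in>{1..n}. LL (mut_clu m j y C))"

lemma upper_bound_mutation:
  assumes "good_seed m n y C" "n \<le> m" "k \<in> {1..n}"
  shows "upper_bound m n y C \<subseteq> upper_bound m n (mut_clu m k y C) (mut_mat k C)"
  using upper_bound_step[OF assms] assms(3) unfolding upper_bound_def by auto

lemma upper_bound_mut_equiv:
  assumes "good_seed m n x B" "n \<le> m" "(y, C) \<in> mut_equiv m n x B"
  shows "good_seed m n y C \<and> upper_bound m n y C \<subseteq> upper_bound m n x B"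
  using assms(3)
proof (induction rule: mut_equiv.induct)
  case refl
  then show ?case using assms(1) by simp
next
  case (step y C k)
  then have k: "k \<in> {1..n}" and g: "good_seed m n y C" by auto
  note g' = good_seed_mutation[OF g assms(2) k]
  \<comment> \<open>The inclusion of \<open>upper_bound_mutation\<close> is applied at the mutated
    seed, whose mutation at \<open>k\<close> is the old seed; this reverses it.\<close>
  have "upper_bound m n (mut_clu m k y C) (mut_mat k C) \<subseteq> upper_bound m n y C"
    using upper_bound_mutation[OF g'(1) assms(2) k] by (simp add: g'(2) mut_mat_involutive)
  then show ?case using g'(1) step by blast
qed

lemma mut_clu_in_LL:
  assumes "0 \<notin> range y"
  shows "mut_clu m k y C i \<in> LL y"
proof (cases "i = k")
  case True
  have "inverse (y k) * lev y (binom m C k) \<in> LL y"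
    by (intro LL_mult[OF assms] LL_inverse_var[OF assms] LL_lev)
  then show ?thesis using True by (simp add: mut_clu_exch lev_binom)
qed (simp add: mut_clu_exch LL_var)

text \<open>A variable lies in the upper bound of its own seed, because that seed is one mutation
  away from each neighbour. The inclusion of upper bounds carries it to \<open>x\<close>.\<close>

theorem laurent_phenomenon_full_rank:
  assumes "good_seed m n x B" "n \<le> m" "(y, C) \<in> mut_equiv m n x B"
  shows "y i \<in> LL x"
proof -
  have g: "good_seed m n y C" and sub: "upper_bound m n y C \<subseteq> upper_bound m n x B"
    using upper_bound_mut_equiv[OF assms] by auto
  have "y i \<in> LL (mut_clu m j y C)" if j: "j \<in> {1..n}" for j
  proof -
    note g' = good_seed_mutation[OF g assms(2) j]
    have "0 \<notin> range (mut_clu m j y C)" using g'(1) by (simp add: good_seed_def lindep_def)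
    then show ?thesis using mut_clu_in_LL[of "mut_clu m j y C" m j "mut_mat j C" i]
      by (simp add: g'(2))
  qed
  then have "y i \<in> upper_bound m n y C" by (simp add: upper_bound_def LL_var)
  then show ?thesis using sub by (auto simp: upper_bound_def)
qed

end

subsection \<open>The field of rational functions in infinitely many variables\<close>

interpretation G: coef_hom_0 "of_int :: int \<Rightarrow> int laurent fract"
  by unfold_locales simp_all

definition gvar :: "nat \<Rightarrow> int laurent fract" where
  "gvar i = Fract (single (single i 1) 1) 1"

lemma Fract_single_add:
  "Fract (single (e + f) 1) 1 = Fract (single e 1) 1 * (Fract (single f 1) 1 :: int laurent fract)"
  by (simp add: mult_single)

lemma single_1_neq_0: "single (e::expo) (1::int) \<noteq> 0"
  by (metis lookup_single_eq lookup_zero zero_neq_one)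

lemma gvar_power_int: "gvar i powi a = Fract (single (single i a) 1) 1"
proof -
  have nat: "gvar i ^ n = Fract (single (single i (int n)) 1) 1" for n
  proof (induction n)
    case (Suc n)
    have "single i (int (Suc n)) = single i 1 + single i (int n)"
      by (simp add: single_add[symmetric])
    then show ?case using Suc Fract_single_add[of "single i 1" "single i (int n)"]
      by (simp add: gvar_def)
  qed (simp add: One_fract_def)
  show ?thesis
  proof (cases "a \<ge> 0")
    case True
    then show ?thesis using nat[of "nat a"] by (simp add: power_int_def)
  next
    case False
    let ?P = "\<lambda>b. Fract (single (single i b) 1) 1 :: int laurent fract"
    have "?P a * ?P (- a) = 1"
      using Fract_single_add[of "single i a" "single i (- a)"]
      by (simp add: single_add[symmetric] One_fract_def)
    then have "?P a = inverse (?P (- a))" by (metis inverse_unique inverse_inverse_eq)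
    then show ?thesis using False nat[of "nat (- a)"] by (simp add: power_int_def power_inverse)
  qed
qed

lemma mon_gvar: "mon gvar e = Fract (single e 1) 1"
proof -
  have prod: "(\<Prod>i\<in>S. gvar i powi f i) = Fract (single (\<Sum>i\<in>S. single i (f i)) 1) 1" if "finite S" for S f
    using that
  proof induction
    case (insert i S)
    then show ?case using Fract_single_add[of "single i (f i)" "\<Sum>i\<in>S. single i (f i)"]
      by (simp add: gvar_power_int)
  qed (simp add: One_fract_def)
  have "mon gvar e = Fract (single (\<Sum>i\<in>keys e. single i (lookup e i)) 1) 1"
    unfolding mon_def by (rule prod) simp
  then show ?thesis by (simp only: poly_mapping_eq_sum_single[of e, symmetric])
qed

lemma lev_gvar: "G.lev gvar p = Fract p 1"
proof (induction p rule: poly_mapping_single_induct)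
  case (single e c)
  have int: "of_int c = (Fract (of_int c) 1 :: int laurent fract)"
    by (cases c rule: int_cases2) (simp_all add: of_nat_fract)
  have "single e c = of_int c * single e (1::int)"
    by (simp add: single_of_int[symmetric] mult_single del: single_of_int)
  moreover have "G.lev gvar (single e c) = Fract (of_int c * single e 1) 1"
    by (simp add: G.lev_single mon_gvar int)
  ultimately show ?case by (simp only:)
qed (simp_all add: G.lev_add Zero_fract_def)

lemma lindep_gvar: "G.lindep UNIV UNIV gvar"
proof -
  have "0 \<notin> range gvar"
    by (auto simp: gvar_def Zero_fract_def eq_fract single_1_neq_0)
  moreover have "p = 0" if "G.lev gvar p = 0" for p
    using that by (simp add: lev_gvar Zero_fract_def eq_fract)
  ultimately show ?thesis by (simp add: G.lindep_def)
qed

subsection \<open>Nonnegative exponents of frozen variables\<close>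

definition nonneg_in :: "nat \<Rightarrow> int laurent \<Rightarrow> bool" where
  "nonneg_in t p \<longleftrightarrow> (\<forall>e\<in>keys p. 0 \<le> lookup e t)"

text \<open>The target is an ordered field: \<open>lev\<close> needs inverses, and augmentations are
  compared with 0.\<close>

interpretation Q: coef_hom_0 "of_int :: int \<Rightarrow> rat"
  by unfold_locales simp_all

text \<open>On Laurent polynomials that are polynomial in the \<open>t\<close>-th variable, \<open>aug t\<close> is the ring
  homomorphism that sets this variable to \<open>0\<close> and all others to \<open>1\<close>. Cluster variables have a
  positive image, which excludes cancellation in the lowest \<open>t\<close>-degree.\<close>

definition aug :: "nat \<Rightarrow> int laurent \<Rightarrow> rat" where
  "aug t p = Q.lev (\<lambda>_. 1) (gpart (\<lambda>e. lookup e t) 0 p)"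

lemma nonneg_in_add: "nonneg_in t p \<Longrightarrow> nonneg_in t q \<Longrightarrow> nonneg_in t (p + q)"
  unfolding nonneg_in_def using Poly_Mapping.keys_add[of p q] by blast

lemma nonneg_in_mult: "nonneg_in t p \<Longrightarrow> nonneg_in t q \<Longrightarrow> nonneg_in t (p * q)"
  unfolding nonneg_in_def using keys_mult[of p q] by (fastforce simp: lookup_add)

lemma nonneg_in_1: "nonneg_in t 1"
  by (simp add: nonneg_in_def)

lemma aug_add: "aug t (p + q) = aug t p + aug t q"
  by (simp add: aug_def gpart_add Q.lev_add)

lemma aug_mult:
  assumes "nonneg_in t p" "nonneg_in t q"
  shows "aug t (p * q) = aug t p * aug t q"
proof -
  interpret grading "\<lambda>e. lookup e t" by (rule grading_lookup)
  have "gpart (\<lambda>e. lookup e t) (0 + 0) (p * q) = gpart (\<lambda>e. lookup e t) 0 p * gpart (\<lambda>e. lookup e t) 0 q"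
    by (rule gpart_mult_lowest) (use assms in \<open>auto simp: nonneg_in_def\<close>)
  then show ?thesis by (simp add: aug_def Q.lev_mult)
qed

lemma aug_single: "aug t (single e 1) = (if lookup e t = 0 then 1 else 0)"
proof -
  have "gpart (\<lambda>e. lookup e t) 0 (single e 1) = (if lookup e t = 0 then single e 1 else (0::int laurent))"
    by (rule poly_mapping_eqI) (auto simp: lookup_gpart lookup_single when_def)
  moreover have "mon (\<lambda>_. 1 :: rat) e = 1" by (simp add: mon_def)
  ultimately show ?thesis by (simp add: aug_def)
qed

lemma aug_1: "aug t 1 = 1"
  using aug_single[of t 0] by simp

lemma nonneg_in_power: "nonneg_in t p \<Longrightarrow> nonneg_in t (p ^ n)"
  by (induction n) (auto simp: nonneg_in_1 nonneg_in_mult)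

lemma aug_power: "nonneg_in t p \<Longrightarrow> aug t (p ^ n) = aug t p ^ n"
  by (induction n) (auto simp: aug_1 aug_mult nonneg_in_power)

lemma nonneg_in_prod:
  "(\<And>i. i \<in> S \<Longrightarrow> nonneg_in t (f i)) \<Longrightarrow> nonneg_in t (prod f S)"
  by (induction S rule: infinite_finite_induct) (auto simp: nonneg_in_1 nonneg_in_mult)

lemma aug_prod:
  "(\<And>i. i \<in> S \<Longrightarrow> nonneg_in t (f i)) \<Longrightarrow> aug t (prod f S) = (\<Prod>i\<in>S. aug t (f i))"
  by (induction S rule: infinite_finite_induct) (auto simp: aug_1 aug_mult nonneg_in_prod)

text \<open>A negative lowest degree of \<open>p'\<close> in the variable \<open>t\<close> would
  survive in \<open>q\<close>: its component times the nonzero degree 0 part of \<open>p\<close>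
  does not vanish.\<close>

lemma nonneg_in_quotient:
  assumes "q = p' * p" "nonneg_in t p" "aug t p \<noteq> 0" "nonneg_in t q"
  shows "nonneg_in t p'"
proof (rule ccontr)
  let ?l = "\<lambda>e::expo. lookup e t"
  interpret grading ?l by (rule grading_lookup)
  assume "\<not> nonneg_in t p'"
  then obtain e where e: "e \<in> keys p'" "?l e < 0" by (force simp: nonneg_in_def)
  define a where "a = Min (?l ` keys p')"
  have a_le: "a \<le> ?l e" if "e \<in> keys p'" for e using that by (simp add: a_def)
  have a: "a < 0" using a_le[OF e(1)] e(2) by simp
  have "a \<in> ?l ` keys p'" unfolding a_def using e by (intro Min_in) auto
  then obtain e' where "e' \<in> keys p'" "?l e' = a" by auto
  then have 1: "gpart ?l a p' \<noteq> 0" by (rule gpart_neq_0)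
  have 2: "gpart ?l 0 p \<noteq> 0" using assms(3) by (auto simp: aug_def)
  have "gpart ?l (a + 0) (p' * p) = gpart ?l a p' * gpart ?l 0 p"
    by (rule gpart_mult_lowest) (use a_le assms(2) in \<open>auto simp: nonneg_in_def\<close>)
  moreover have "gpart ?l a q = 0"
    by (rule gpart_eq_0) (use assms(4) a in \<open>auto simp: nonneg_in_def\<close>)
  ultimately show False using 1 2 assms(1) by simp
qed

subsection \<open>The Laurent phenomenon by specialisation\<close>

text \<open>Natural powers are used so that the formula also makes sense for the Laurent polynomials
  \<open>P i\<close>, which need not be invertible.\<close>

lemma exch_prod:
  "exch m k y C = (\<Prod>i\<in>{1..m}. y i ^ nat (C i k)) + (\<Prod>i\<in>{1..m}. y i ^ nat (- C i k))"
proof -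
  have "mon y (posv m C k) = (\<Prod>i\<in>{1..m}. y i ^ nat (C i k))" for C
  proof -
    have "mon y (posv m C k) = (\<Prod>i\<in>{1..m}. y i powi lookup (posv m C k) i)"
      by (rule mon_superset) (use keys_vec in auto)
    also have "\<dots> = (\<Prod>i\<in>{1..m}. y i ^ nat (C i k))"
      by (intro prod.cong HOL.refl) (auto simp: lookup_vec power_int_def max_def)
    finally show ?thesis .
  qed
  from this[of C] this[of "\<lambda>i j. - C i j"] show ?thesis by (simp add: exch_def)
qed

text \<open>Index 0 is sent to 1 as well, so a truncated cluster has no zero entry once its
  \<open>m\<close> genuine entries are nonzero.\<close>

definition trunc :: "nat \<Rightarrow> (nat \<Rightarrow> 'f::field) \<Rightarrow> nat \<Rightarrow> 'f" where
  "trunc m y i = (if i \<in> {1..m} then y i else 1)"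

lemma exch_trunc:
  assumes "m \<le> M" "\<And>i. i \<in> {1..m} \<Longrightarrow> D' i k = D i k"
  shows "exch M k (trunc m w) D' = exch m k w D"
proof -
  have "(\<Prod>i\<in>{1..M}. trunc m w i ^ a i) = (\<Prod>i\<in>{1..m}. w i ^ a i)" for a :: "nat \<Rightarrow> nat"
    by (rule prod.mono_neutral_cong_right) (use assms(1) in \<open>auto simp: trunc_def\<close>)
  then show ?thesis unfolding exch_prod by (simp add: assms(2))
qed

lemma exch_trunc_self: "exch m k (trunc m w) D = exch m k w D"
  by (rule exch_trunc) auto

definition ext_mat :: "nat \<Rightarrow> (nat \<Rightarrow> nat \<Rightarrow> int) \<Rightarrow> nat \<Rightarrow> nat \<Rightarrow> int" where
  "ext_mat m C i j = (if i \<le> m then C i j else if i = m + j then 1 else 0)"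

lemma good_seed_ext:
  assumes "skew_symmetrizable n C" "n \<le> m"
  shows "G.good_seed (m + n) n gvar (ext_mat m C)"
proof -
  have "skew_symmetrizable n (ext_mat m C)"
  proof -
    obtain d where d: "\<forall>i\<in>{1..n}. d i > (0::int)"
      and s: "\<And>i j. i \<in> {1..n} \<Longrightarrow> j \<in> {1..n} \<Longrightarrow> d i * C i j = - (d j * C j i)"
      using assms(1) unfolding skew_symmetrizable_def by blast
    have e: "ext_mat m C i j = C i j" if "i \<in> {1..n}" for i j
      using assms(2) that by (simp add: ext_mat_def)
    have "d i * ext_mat m C i j = - (d j * ext_mat m C j i)" if "i \<in> {1..n}" "j \<in> {1..n}" for i j
      unfolding e[OF that(1)] e[OF that(2)] by (rule s[OF that])
    then show ?thesis using d unfolding skew_symmetrizable_def by blast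
  qed
  moreover have "indep_cols (m + n) n (ext_mat m C)"
    unfolding indep_cols_def
  proof (intro allI impI ballI)
    fix c j assume c: "\<forall>i\<in>{1..m + n}. (\<Sum>j\<in>{1..n}. c j * ext_mat m C i j) = 0" and j: "j \<in> {1..n}"
    \<comment> \<open>Row \<open>m + j\<close> belongs to the identity block and isolates the
      coefficient \<open>c j\<close>.\<close>
    have "0 = (\<Sum>j'\<in>{1..n}. c j' * ext_mat m C (m + j) j')" using c j by auto
    also have "\<dots> = (\<Sum>j'\<in>{1..n}. if j' = j then c j' else 0)"
      by (intro sum.cong HOL.refl) (use j in \<open>auto simp: ext_mat_def\<close>)
    also have "\<dots> = c j" using j by simp
    finally show "c j = 0" by simp
  qed
  ultimately show ?thesis using lindep_gvar by (simp add: G.good_seed_def)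
qed

interpretation Z: coef_hom_0 "of_int :: int \<Rightarrow> 'f::field_char_0"
  by unfold_locales simp_all

text \<open>\<open>P\<close> lists the Laurent expansions of a seed of the extended matrix; they specialise to the
  given seed when all variables beyond the \<open>m\<close>-th are set to \<open>1\<close>.\<close>

definition expansion ::
  "nat \<Rightarrow> nat \<Rightarrow> (nat \<Rightarrow> 'f::field_char_0) \<Rightarrow> (nat \<Rightarrow> 'f) \<Rightarrow> (nat \<Rightarrow> int laurent fract) \<Rightarrow> (nat \<Rightarrow> int laurent) \<Rightarrow> bool"
  where "expansion m n y w W P \<longleftrightarrow>
    (\<forall>i. W i = G.lev gvar (P i) \<and> trunc m w i = Z.lev (trunc m y) (P i) \<and>
      (i \<notin> {1..n} \<longrightarrow> P i = single (single i 1) 1) \<and>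
      (\<forall>t\<in>{n<..m}. nonneg_in t (P i) \<and> (i \<noteq> t \<longrightarrow> aug t (P i) > 0)))"

text \<open>The expansion \<open>p\<close> of the new variable exists by the full rank case. Its
  specialisation and its sign properties are both extracted from the relation
  \<open>q = p * P k\<close>.\<close>

lemma expansion_mutation:
  fixes y :: "nat \<Rightarrow> 'f::field_char_0"
  assumes nm: "n \<le> m" and skew: "skew_symmetrizable n C"
    and y: "0 \<notin> range (trunc m y)" and w: "0 \<notin> range (trunc m w)"
    and WD: "(W, D') \<in> mut_equiv (m + n) n gvar (ext_mat m C)"
    and D: "\<And>i j. i \<in> {1..m} \<Longrightarrow> j \<in> {1..n} \<Longrightarrow> D' i j = D i j"
    and k: "k \<in> {1..n}"
    and P: "expansion m n y w W P"
  shows "\<exists>P. expansion m n y (mut_clu m k w D) (mut_clu (m + n) k W D') P"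
proof -
  let ?M = "m + n" and ?y = "trunc m y"
  note g = good_seed_ext[OF skew nm]
  have gn: "0 \<notin> range gvar" using lindep_gvar by (simp add: G.lindep_def)
  have WD': "(mut_clu ?M k W D', mut_mat k D') \<in> mut_equiv ?M n gvar (ext_mat m C)"
    using mut_equiv.step[OF WD] k by simp
  have "mut_clu ?M k W D' k \<in> G.LL gvar"
    by (rule G.laurent_phenomenon_full_rank[OF g _ WD']) simp
  then obtain p where p: "mut_clu ?M k W D' k = G.lev gvar p" by (auto simp: G.LL_def)
  have "G.good_seed ?M n W D'" using G.upper_bound_mut_equiv[OF g _ WD] by simp
  then have "0 \<notin> range W" by (simp add: G.good_seed_def G.lindep_def)
  then have Wk: "W k \<noteq> 0" by (rule nonzero_at)
  have PW: "W i = G.lev gvar (P i)" and Pw: "trunc m w i = Z.lev ?y (P i)" for i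
    using P by (auto simp: expansion_def)
  have Pfrozen: "P i = single (single i 1) 1" if "i \<notin> {1..n}" for i
    using P that by (auto simp: expansion_def)
  define q where "q = (\<Prod>i\<in>{1..?M}. P i ^ nat (D' i k)) + (\<Prod>i\<in>{1..?M}. P i ^ nat (- D' i k))"
  have "G.lev gvar (p * P k) = G.lev gvar q"
  proof -
    have "G.lev gvar (p * P k) = mut_clu ?M k W D' k * W k"
      by (simp add: G.lev_mult[OF gn] p PW)
    also have "\<dots> = exch ?M k W D'" using Wk by (simp add: mut_clu_exch)
    also have "\<dots> = G.lev gvar q"
      unfolding exch_prod q_def by (simp add: G.lev_add G.lev_prod[OF gn] G.lev_power[OF gn] PW)
    finally show ?thesis .
  qed
  \<comment> \<open>Independence of \<open>gvar\<close> makes the exchange relation an identity of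
    Laurent polynomials, which may be evaluated wherever no variable is 0.\<close>
  then have q: "q = p * P k" using G.lindep_inj[OF lindep_gvar] by metis
  have km: "k \<in> {1..m}" using k nm by auto
  have wk: "w k \<noteq> 0" using nonzero_at[OF w, of k] km by (simp add: trunc_def)
  have "Z.lev ?y p * w k = exch m k w D"
  proof -
    have "Z.lev ?y p * w k = Z.lev ?y q"
      unfolding q using Pw[of k] km by (simp add: Z.lev_mult[OF y] trunc_def)
    also have "\<dots> = exch ?M k (trunc m w) D'"
      unfolding exch_prod q_def Pw by (simp add: Z.lev_add Z.lev_prod[OF y] Z.lev_power[OF y])
    also have "\<dots> = exch m k w D" by (rule exch_trunc) (use D k in auto)
    finally show ?thesis .
  qed
  then have pw: "mut_clu m k w D k = Z.lev ?y p" using wk by (simp add: mut_clu_exch field_simps)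
  have pos: "nonneg_in t p \<and> aug t p > 0" if t: "t \<in> {n<..m}" for t
  proof -
    have nn: "nonneg_in t (P i)" and au: "i \<noteq> t \<Longrightarrow> aug t (P i) > 0" for i
      using P t by (auto simp: expansion_def)
    have "aug t (P t) = 0" using Pfrozen[of t] t by (simp add: aug_single)
    then have au0: "aug t (P i) \<ge> 0" for i using au[of i] by (cases "i = t") auto
    have nq: "nonneg_in t q" unfolding q_def
      by (intro nonneg_in_add nonneg_in_prod nonneg_in_power nn)
    have aq: "aug t q = (\<Prod>i\<in>{1..?M}. aug t (P i) ^ nat (D' i k)) + (\<Prod>i\<in>{1..?M}. aug t (P i) ^ nat (- D' i k))"
      unfolding q_def by (simp add: aug_add aug_prod aug_power nonneg_in_power nn)
    have prod0: "(\<Prod>i\<in>{1..?M}. aug t (P i) ^ a i) \<ge> 0" for a :: "nat \<Rightarrow> nat"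
      by (intro prod_nonneg ballI zero_le_power au0)
    have prod1: "(\<Prod>i\<in>{1..?M}. aug t (P i) ^ a i) > 0" if "a t = 0" for a :: "nat \<Rightarrow> nat"
    proof (rule prod_pos)
      fix i show "0 < aug t (P i) ^ a i" using au[of i] that by (cases "i = t") auto
    qed
    \<comment> \<open>The variable \<open>t\<close> occurs in at most one of the two exchange
      monomials; the other one has positive augmentation.\<close>
    have "aug t q > 0"
    proof (cases "D' t k \<le> 0")
      case True
      show ?thesis unfolding aq
        by (rule add_pos_nonneg[OF prod1 prod0]) (use True in simp)
    next
      case False
      show ?thesis unfolding aq
        by (rule add_nonneg_pos[OF prod0 prod1]) (use False in simp)
    qed
    moreover have auk: "aug t (P k) > 0" using au[of k] k t by auto
    moreover have np: "nonneg_in t p"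
      by (rule nonneg_in_quotient[OF q nn _ nq]) (use auk in simp)
    ultimately show ?thesis using aug_mult[OF np nn[of k]] q by (simp add: zero_less_mult_iff)
  qed
  have "expansion m n y (mut_clu m k w D) (mut_clu ?M k W D') (P(k := p))"
    unfolding expansion_def
  proof (intro allI)
    fix i
    show "mut_clu ?M k W D' i = G.lev gvar ((P(k := p)) i)
      \<and> trunc m (mut_clu m k w D) i = Z.lev ?y ((P(k := p)) i)
      \<and> (i \<notin> {1..n} \<longrightarrow> (P(k := p)) i = single (single i 1) 1)
      \<and> (\<forall>t\<in>{n<..m}. nonneg_in t ((P(k := p)) i) \<and> (i \<noteq> t \<longrightarrow> aug t ((P(k := p)) i) > 0))"
    proof (cases "i = k")
      case True
      then show ?thesis using p pw pos k km by (auto simp: trunc_def)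
    next
      case False
      have "trunc m (mut_clu m k w D) i = trunc m w i" "mut_clu ?M k W D' i = W i"
        using False by (auto simp: trunc_def mut_clu_exch)
      then show ?thesis using P False unfolding expansion_def by simp
    qed
  qed
  then show ?thesis by blast
qed

text \<open>The same mutations are performed on the extended seed. The first \<open>m\<close> rows
  mutate independently of the rows below, so \<open>D'\<close> and \<open>D\<close> keep agreeing
  there; nonvanishing of the clusters permits the divisions after specialisation.\<close>

theorem laurent_phenomenon:
  fixes y :: "nat \<Rightarrow> 'f::field_char_0"
  assumes nm: "n \<le> m" and skew: "skew_symmetrizable n C"
    and nz: "\<And>w D. (w, D) \<in> mut_equiv m n y C \<Longrightarrow> 0 \<notin> range (trunc m w)"
    and wD: "(w, D) \<in> mut_equiv m n y C" and i: "i \<in> {1..m}"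
  obtains p where "w i = Z.lev (trunc m y) p" "\<And>t. t \<in> {n<..m} \<Longrightarrow> nonneg_in t p"
proof -
  have y: "0 \<notin> range (trunc m y)" using nz[OF mut_equiv.refl] .
  have "\<exists>W D' P. (W, D') \<in> mut_equiv (m + n) n gvar (ext_mat m C) \<and>
      (\<forall>i\<in>{1..m}. \<forall>j\<in>{1..n}. D' i j = D i j) \<and> expansion m n y w W P"
    using wD
  proof (induction rule: mut_equiv.induct)
    case refl
    have "expansion m n y y gvar (\<lambda>i. single (single i 1) 1)"
      unfolding expansion_def
      by (auto simp: lev_gvar gvar_def aug_single nonneg_in_def lookup_single when_def)
    moreover have "(gvar, ext_mat m C) \<in> mut_equiv (m + n) n gvar (ext_mat m C)"
      by (rule mut_equiv.refl)
    moreover have "\<forall>i\<in>{1..m}. \<forall>j\<in>{1..n}. ext_mat m C i j = C i j" by (simp add: ext_mat_def)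
    ultimately show ?case by blast
  next
    case (step w D k)
    then obtain W D' P where W: "(W, D') \<in> mut_equiv (m + n) n gvar (ext_mat m C)"
      and D': "\<And>i j. i \<in> {1..m} \<Longrightarrow> j \<in> {1..n} \<Longrightarrow> D' i j = D i j" and P: "expansion m n y w W P"
      by blast
    have k: "k \<in> {1..n}" using step by simp
    obtain P' where "expansion m n y (mut_clu m k w D) (mut_clu (m + n) k W D') P'"
      using expansion_mutation[OF nm skew y nz[OF step(1)] W D' k P] by blast
    moreover have "mut_mat k D' i j = mut_mat k D i j" if "i \<in> {1..m}" "j \<in> {1..n}" for i j
    proof -
      have "D' i j = D i j" "D' i k = D i k" "D' k j = D k j"
        using D' that k nm by auto
      then show ?thesis by (simp add: mut_mat_def)
    qed
    moreover have "(mut_clu (m + n) k W D', mut_mat k D') \<in> mut_equiv (m + n) n gvar (ext_mat m C)"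
      using mut_equiv.step[OF W] k by simp
    ultimately show ?case by blast
  qed
  then obtain W P where P: "expansion m n y w W P" by blast
  have "w i = Z.lev (trunc m y) (P i)" "\<And>t. t \<in> {n<..m} \<Longrightarrow> nonneg_in t (P i)"
    using P[unfolded expansion_def, THEN spec, of i] i by (auto simp: trunc_def)
  then show ?thesis using that by blast
qed

subsection \<open>Seeds over a subring\<close>

text \<open>Coefficients are now field elements, and \<open>lring\<close> records that they lie in
  \<open>K\<close>. This treats subfields and the integers alike.\<close>

interpretation I: coef_hom_0 "\<lambda>a::'f::field_char_0. a"
  by unfold_locales simp_all

lemma base_ring_subring:
  fixes K :: "'f::field_char_0 set"
  assumes "base_ring K"
  shows "subring_set K"
proof (cases "is_subfield K")
  case True
  then have "0 \<in> K" "\<And>a b. a \<in> K \<Longrightarrow> b \<in> K \<Longrightarrow> a - b \<in> K" by (auto simp: is_subfield_def)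
  then have "- a \<in> K" if "a \<in> K" for a using that by (metis diff_0)
  then show ?thesis using True by (auto simp: is_subfield_def subring_set_def)
next
  case False
  then show ?thesis using assms by (auto simp: base_ring_def subring_set_def)
qed

lemma subring_set_of_int: "subring_set K \<Longrightarrow> of_int c \<in> K"
proof (induction c rule: int_induct[where k = 0])
  case (step2 i)
  have "of_int i + - (1::'a) \<in> K" using step2 unfolding subring_set_def by blast
  then show ?case by simp
qed (auto simp: subring_set_def)

lemma lindep_inj_on:
  fixes y :: "nat \<Rightarrow> 'f::field_char_0"
  assumes K: "subring_set K" and y: "I.lindep K V y"
    and pq: "p \<in> lring K (supp_in V)" "q \<in> lring K (supp_in V)" and eq: "I.lev y p = I.lev y q"
  shows "p = q"
proof -
  interpret laurent_ring K "supp_in V" by unfold_locales (use K submonoid_supp_in in auto)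
  have "p + - q \<in> lring K (supp_in V)" by (intro lring_add lring_uminus pq)
  moreover have "I.lev y (p + - q) = 0" by (simp add: I.lev_add I.lev_uminus eq del: add_uminus_conv_diff)
  ultimately have "p + - q = 0" using y unfolding I.lindep_def by blast
  then show ?thesis by simp
qed

text \<open>The monomial \<open>U\<close> clears all negative exponents. The shift \<open>F\<close>
  is injective on the support, so a Laurent relation becomes a polynomial relation with the same
  coefficients.\<close>

lemma alg_indep_lindep:
  fixes x :: "nat \<Rightarrow> 'f::field_char_0"
  assumes K: "subring_set K" and x: "alg_indep K m x"
  shows "I.lindep K {1..m} (trunc m x)"
proof -
  have x0: "x i \<noteq> 0" if i: "i \<in> {1..m}" for i
  proof
    assume 0: "x i = 0"
    define e where "e = (\<lambda>j. if j = i then 1 else 0 :: nat)"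
    have "monom_val m x e = 0" unfolding monom_val_def using i 0 by (auto simp: e_def)
    moreover have "e \<in> exps m" using i by (auto simp: exps_def e_def)
    ultimately have "\<forall>e'\<in>{e}. (1::'f) = 0"
      using x[unfolded alg_indep_def, THEN spec, THEN spec, of "{e}" "\<lambda>_. 1"] K
      by (simp add: subring_set_def)
    then show False by simp
  qed
  have nz: "0 \<notin> range (trunc m x)" using x0 by (auto simp: trunc_def split: if_splits)
  moreover have "p = 0" if p: "p \<in> lring K (supp_in {1..m})" "I.lev (trunc m x) p = 0" for p
  proof -
    define N where "N = (\<Sum>e\<in>keys p. \<Sum>i\<in>{1..m}. nat \<bar>lookup e i\<bar>)"
    have N: "lookup e i + int N \<ge> 0" if "e \<in> keys p" "i \<in> {1..m}" for e i
    proof -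
      have "nat \<bar>lookup e i\<bar> \<le> (\<Sum>i\<in>{1..m}. nat \<bar>lookup e i\<bar>)"
        by (rule member_le_sum) (use that in auto)
      also have "\<dots> \<le> N" unfolding N_def
        by (rule member_le_sum[where f = "\<lambda>e. \<Sum>i\<in>{1..m}. nat \<bar>lookup e i\<bar>"]) (use that in auto)
      finally show ?thesis by linarith
    qed
    define F where "F = (\<lambda>e::expo. \<lambda>i. if i \<in> {1..m} then nat (lookup e i + int N) else 0)"
    have supp: "lookup e i = 0" if "e \<in> keys p" "i \<notin> {1..m}" for e i
      using p(1) that by (auto simp: lring_def supp_in_def in_keys_iff subset_iff)
    have inj: "inj_on F (keys p)"
    proof (rule inj_onI)
      fix e f assume ef: "e \<in> keys p" "f \<in> keys p" "F e = F f"
      show "e = f"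
      proof (rule poly_mapping_eqI)
        fix i show "lookup e i = lookup f i"
        proof (cases "i \<in> {1..m}")
          case True
          then have "nat (lookup e i + int N) = nat (lookup f i + int N)"
            using fun_cong[OF ef(3), of i] by (simp add: F_def)
          then show ?thesis using N[OF ef(1) True] N[OF ef(2) True] by linarith
        qed (simp add: supp ef)
      qed
    qed
    define U where "U = (\<Prod>i\<in>{1..m}. x i ^ N)"
    have mv: "monom_val m x (F e) = mon (trunc m x) e * U" if e: "e \<in> keys p" for e
    proof -
      have "mon (trunc m x) e = (\<Prod>i\<in>{1..m}. trunc m x i powi lookup e i)"
        by (rule mon_superset) (use p(1) e in \<open>auto simp: lring_def supp_in_def\<close>)
      also have "\<dots> * U = (\<Prod>i\<in>{1..m}. x i powi lookup e i * x i ^ N)"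
        unfolding U_def prod.distrib[symmetric] by (intro prod.cong HOL.refl) (simp add: trunc_def)
      also have "\<dots> = (\<Prod>i\<in>{1..m}. x i ^ F e i)"
      proof (intro prod.cong HOL.refl)
        fix i assume i: "i \<in> {1..m}"
        have "x i powi lookup e i * x i ^ N = x i powi (lookup e i + int N)"
          using x0[OF i] by (simp add: power_int_add)
        also have "\<dots> = x i ^ nat (lookup e i + int N)"
          using N[OF e i] by (simp add: power_int_def)
        finally show "x i powi lookup e i * x i ^ N = x i ^ F e i" using i by (simp add: F_def)
      qed
      finally show ?thesis by (simp add: monom_val_def)
    qed
    define c where "c = (\<lambda>s. lookup p (inv_into (keys p) F s))"
    have c: "c (F e) = lookup p e" if "e \<in> keys p" for e
      using that inj by (simp add: c_def)
    have "(\<Sum>s\<in>F ` keys p. c s * monom_val m x s) = (\<Sum>e\<in>keys p. lookup p e * mon (trunc m x) e * U)"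
      unfolding sum.reindex[OF inj] by (intro sum.cong HOL.refl) (simp add: c mv mult.assoc)
    also have "\<dots> = I.lev (trunc m x) p * U" by (simp add: I.lev_def sum_distrib_right)
    finally have "(\<Sum>s\<in>F ` keys p. c s * monom_val m x s) = 0" using p by simp
    moreover have "F ` keys p \<subseteq> exps m" by (auto simp: F_def exps_def)
    moreover have "\<forall>s\<in>F ` keys p. c s \<in> K" using p by (auto simp: c_def lring_def)
    moreover have "finite (F ` keys p)" by simp
    ultimately have "\<forall>s\<in>F ` keys p. c s = 0"
      by (intro x[unfolded alg_indep_def, THEN spec, THEN spec, THEN mp] conjI)
    then have "lookup p e = 0" if "e \<in> keys p" for e using that c by force
    then have "keys p = {}" by (meson all_not_in_conv in_keys_iff)
    then show ?thesis by simp
  qed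
  ultimately show ?thesis by (simp add: I.lindep_def)
qed

definition nonzero_cols :: "nat \<Rightarrow> nat \<Rightarrow> (nat \<Rightarrow> nat \<Rightarrow> int) \<Rightarrow> bool" where
  "nonzero_cols m n C \<longleftrightarrow> (\<forall>k\<in>{1..n}. \<exists>i\<in>{1..m}. C i k \<noteq> 0)"

text \<open>As \<open>1 < m\<close>, vertex \<open>k\<close> must have an edge. If the edge comes
  from an entry in row \<open>k\<close> of the principal part, skew-symmetrizability moves it into
  column \<open>k\<close>.\<close>

lemma nonzero_cols_connected:
  assumes "connected_mat m n B" "skew_symmetrizable n B" "1 < m" "n \<le> m"
  shows "nonzero_cols m n B"
  unfolding nonzero_cols_def
proof
  fix k assume k: "k \<in> {1..n}"
  define i where "i = (if k = 1 then 2 else 1 :: nat)"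
  have "i \<in> {1..m}" "i \<noteq> k" "k \<in> {1..m}" using assms k by (auto simp: i_def)
  then have "(mat_edge m n B)\<^sup>*\<^sup>* k i" "k \<noteq> i" using assms(1) by (auto simp: connected_mat_def)
  then obtain j where j: "mat_edge m n B k j" by (metis converse_rtranclpE)
  then have "j \<in> {1..m}" by (simp add: mat_edge_def)
  moreover have "B j k \<noteq> 0"
  proof (cases "j \<le> n \<and> B k j \<noteq> 0")
    case True
    then show ?thesis using skew_symmetrizable_sign(2)[OF assms(2) k, of j] \<open>j \<in> {1..m}\<close> by simp
  next
    case False
    then show ?thesis using j by (auto simp: mat_edge_def)
  qed
  ultimately show "\<exists>i\<in>{1..m}. B i k \<noteq> 0" by blast
qed

text \<open>If \<open>C j k = 0\<close>, column \<open>k\<close> changes at most by signs; otherwise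
  its entry in row \<open>j\<close> only changes sign.\<close>

lemma nonzero_cols_mut_mat:
  assumes "nonzero_cols m n C" "j \<in> {1..m}"
  shows "nonzero_cols m n (mut_mat j C)"
  unfolding nonzero_cols_def
proof
  fix k assume k: "k \<in> {1..n}"
  obtain i where i: "i \<in> {1..m}" "C i k \<noteq> 0" using assms(1) k unfolding nonzero_cols_def by blast
  show "\<exists>i\<in>{1..m}. mut_mat j C i k \<noteq> 0"
  proof (cases "C j k = 0")
    case True
    then have "mut_mat j C i k \<noteq> 0" using i by (auto simp: mut_mat_alt)
    then show ?thesis using i by blast
  next
    case False
    then have "mut_mat j C j k \<noteq> 0" by (simp add: mut_mat_alt)
    then show ?thesis using assms(2) by blast
  qed
qed

lemma posv_neq_negv:
  assumes "nonzero_cols m n C" "k \<in> {1..n}"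
  shows "posv m C k \<noteq> negv m C k"
proof
  assume eq: "posv m C k = negv m C k"
  obtain i where i: "i \<in> {1..m}" "C i k \<noteq> 0" using assms unfolding nonzero_cols_def by blast
  then show False using arg_cong[OF eq, of "\<lambda>e. lookup e i"] by (auto simp: lookup_vec max_def split: if_splits)
qed

definition seed_ok :: "'f::field_char_0 set \<Rightarrow> nat \<Rightarrow> nat \<Rightarrow> (nat \<Rightarrow> 'f) \<Rightarrow> (nat \<Rightarrow> nat \<Rightarrow> int) \<Rightarrow> bool" where
  "seed_ok K m n y C \<longleftrightarrow> I.lindep K {1..m} (trunc m y) \<and> skew_symmetrizable n C \<and> nonzero_cols m n C"

lemma trunc_mut_clu:
  "k \<in> {1..m} \<Longrightarrow> trunc m (mut_clu m k y C) = mut_clu m k (trunc m y) C"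
  by (auto simp: mut_clu_exch exch_trunc_self trunc_def fun_eq_iff)

lemma seed_ok_mutation:
  assumes K: "subring_set K" and nm: "n \<le> m" and s: "seed_ok K m n y C" and k: "k \<in> {1..n}"
  shows "seed_ok K m n (mut_clu m k y C) (mut_mat k C)"
    and "mut_clu m k (mut_clu m k y C) (mut_mat k C) = y"
proof -
  have y: "I.lindep K {1..m} (trunc m y)" and C: "skew_symmetrizable n C" "nonzero_cols m n C"
    using s by (auto simp: seed_ok_def)
  have km: "k \<in> {1..m}" using k nm by auto
  have kk: "C k k = 0" by (rule skew_symmetrizable_diag[OF C(1) k])
  have y': "I.lindep K {1..m} (trunc m (mut_clu m k y C))"
    unfolding trunc_mut_clu[OF km] by (rule I.lindep_mut_clu[where C = C, OF K _ y kk]) simp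
  then show "seed_ok K m n (mut_clu m k y C) (mut_mat k C)"
    using skew_symmetrizable_mut_mat[OF C(1) k] nonzero_cols_mut_mat[OF C(2) km]
    by (simp add: seed_ok_def)
  have "trunc m y k \<noteq> 0" "trunc m (mut_clu m k y C) k \<noteq> 0"
    by (rule nonzero_at, use y y' in \<open>simp add: I.lindep_def\<close>)+
  then have "y k \<noteq> 0" "mut_clu m k y C k \<noteq> 0" using km by (auto simp: trunc_def)
  then show "mut_clu m k (mut_clu m k y C) (mut_mat k C) = y"
    by (rule mut_clu_involutive[where C = C, OF kk])
qed

text \<open>Symmetry of the equivalence is included so that cluster variables reached from
  \<open>x\<close> can be expanded in every equivalent cluster \<open>y\<close>.\<close>

lemma seed_ok_mut_equiv:
  assumes "subring_set K" "n \<le> m" "seed_ok K m n x B" "(y, C) \<in> mut_equiv m n x B"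
  shows "seed_ok K m n y C \<and> (x, B) \<in> mut_equiv m n y C \<and> (\<forall>i. i \<notin> {1..n} \<longrightarrow> y i = x i)"
  using assms(4)
proof (induction rule: mut_equiv.induct)
  case refl
  then show ?case using assms mut_equiv.refl by simp
next
  case (step y C k)
  then have k: "k \<in> {1..n}" by simp
  have s: "seed_ok K m n y C" and xB: "(x, B) \<in> mut_equiv m n y C" using step by auto
  note mu = seed_ok_mutation[OF assms(1,2) s k]
  have "(mut_clu m k (mut_clu m k y C) (mut_mat k C), mut_mat k (mut_mat k C))
      \<in> mut_equiv m n (mut_clu m k y C) (mut_mat k C)"
    by (rule mut_equiv.step[OF mut_equiv.refl]) (use k in auto)
  then have "(y, C) \<in> mut_equiv m n (mut_clu m k y C) (mut_mat k C)"
    by (simp add: mu(2) mut_mat_involutive)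
  then have "(x, B) \<in> mut_equiv m n (mut_clu m k y C) (mut_mat k C)"
    using mut_equiv_trans[OF xB] by blast
  moreover have "mut_clu m k y C i = x i" if "i \<notin> {1..n}" for i
    using step that k by (auto simp: mut_clu_exch)
  ultimately show ?case using mu(1) by blast
qed

subsection \<open>Cluster algebras inside Laurent rings\<close>

definition frozen_exps :: "nat \<Rightarrow> nat \<Rightarrow> expo set" where
  "frozen_exps m p = {e. keys e \<subseteq> {1..m} \<and> (\<forall>t\<in>{p<..m}. 0 \<le> lookup e t)}"

lemma submonoid_frozen_exps: "submonoid (frozen_exps m p)"
  unfolding submonoid_def frozen_exps_def
  using Poly_Mapping.keys_add by (fastforce simp: lookup_add)

lemma frozen_exps_single:
  assumes "i \<in> {1..m}" "0 \<le> a \<or> i \<le> p"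
  shows "single i a \<in> frozen_exps m p"
  using assms by (cases "a = 0") (auto simp: frozen_exps_def lookup_single when_def)

lemma lring_frozen_supp: "lring K (frozen_exps m p) \<subseteq> lring K (supp_in {1..m})"
  by (auto simp: lring_def frozen_exps_def supp_in_def)

lemma cluster_variable_in_lring:
  fixes y :: "nat \<Rightarrow> 'f::field_char_0"
  assumes K: "subring_set K" and nm: "n \<le> p" "p \<le> m" and s: "seed_ok K m n y C"
    and w: "(w, D) \<in> mut_equiv m n y C" and i: "i \<in> {1..m}"
  shows "\<exists>q\<in>lring K (frozen_exps m p). w i = I.lev (trunc m y) q"
proof -
  interpret laurent_ring K "frozen_exps m p"
    by unfold_locales (use K submonoid_frozen_exps in auto)
  have nm': "n \<le> m" using nm by simp
  have nz: "0 \<notin> range (trunc m w)" if "(w, D) \<in> mut_equiv m n y C" for w D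
    using seed_ok_mut_equiv[OF K nm' s that] by (simp add: seed_ok_def I.lindep_def)
  have skew: "skew_symmetrizable n C" using s by (simp add: seed_ok_def)
  obtain r where r: "w i = Z.lev (trunc m y) r" "\<And>t. t \<in> {n<..m} \<Longrightarrow> nonneg_in t r"
  proof (rule laurent_phenomenon[OF nm' skew _ w i])
    show "0 \<notin> range (trunc m w)" if "(w, D) \<in> mut_equiv m n y C" for w D by (rule nz[OF that])
  qed (use that in auto)
  \<comment> \<open>Exponents at indices outside \<open>{1..m}\<close> are discarded, since
    \<open>trunc m y\<close> is 1 there. Different exponents may thereby merge, hence a sum.\<close>
  define q :: "'f laurent" where "q = (\<Sum>e\<in>keys r. single (vec m (lookup e)) (of_int (lookup r e)))"
  have "mon (trunc m y) (vec m (lookup e)) = mon (trunc m y) e" for e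
  proof -
    let ?S = "{1..m} \<union> keys e"
    have "mon (trunc m y) (vec m (lookup e)) = (\<Prod>i\<in>?S. trunc m y i powi lookup (vec m (lookup e)) i)"
      by (rule mon_superset) (use keys_vec[of m "lookup e"] in auto)
    also have "\<dots> = (\<Prod>i\<in>?S. trunc m y i powi lookup e i)"
      by (intro prod.cong HOL.refl) (auto simp: lookup_vec trunc_def)
    also have "\<dots> = mon (trunc m y) e" by (rule mon_superset[symmetric]) auto
    finally show ?thesis .
  qed
  then have "I.lev (trunc m y) q = w i"
    by (simp add: q_def I.lev_sum I.lev_single r(1) Z.lev_def)
  moreover have "q \<in> lring K (frozen_exps m p)"
    unfolding q_def
  proof (intro lring_sum lring_single subring_set_of_int K)
    fix e assume "e \<in> keys r"
    then have "0 \<le> lookup e t" if "t \<in> {p<..m}" for t using r(2)[of t] that nm by (auto simp: nonneg_in_def)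
    then show "vec m (lookup e) \<in> frozen_exps m p"
      using keys_vec by (auto simp: frozen_exps_def lookup_vec)
  qed
  ultimately show ?thesis by metis
qed

lemma cluster_algebra_in_lring:
  fixes x :: "nat \<Rightarrow> 'f::field_char_0"
  assumes K: "subring_set K" and nm: "n \<le> p" "p \<le> m" and s: "seed_ok K m n x B"
    and yC: "(y, C) \<in> mut_equiv m n x B" and f: "f \<in> cluster_algebra K m p n x B"
  shows "\<exists>q\<in>lring K (frozen_exps m p). f = I.lev (trunc m y) q"
proof -
  interpret laurent_ring K "frozen_exps m p"
    by unfold_locales (use K submonoid_frozen_exps in auto)
  have nm': "n \<le> m" using nm by simp
  have sy: "seed_ok K m n y C" and xy: "(x, B) \<in> mut_equiv m n y C"
    and frozen: "\<And>i. i \<notin> {1..n} \<Longrightarrow> y i = x i"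
    using seed_ok_mut_equiv[OF K nm' s yC] by auto
  have nz: "0 \<notin> range (trunc m y)" using sy by (simp add: seed_ok_def I.lindep_def)
  have powi: "\<exists>q\<in>lring K (frozen_exps m p). x i powi a = I.lev (trunc m y) q"
    if "n < i" "i \<le> m" "0 \<le> a \<or> i \<le> p" for i a
    using that frozen[of i]
    by (intro bexI[of _ "single (single i a) 1"] lring_single_1 frozen_exps_single) (auto simp: trunc_def)
  show ?thesis using f unfolding cluster_algebra_def
  proof (induction rule: alg_gen.induct)
    case (base a)
    then show ?case using E
      by (intro bexI[of _ "single 0 a"] lring_single) (auto simp: I.lev_single submonoid_def)
  next
    case (gen g)
    then consider i where "g = x i" "n < i" "i \<le> m" | i where "g = inverse (x i)" "n < i" "i \<le> p"
      | "g \<in> cluster_variables m n x B" using nm by force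
    then show ?case
    proof cases
      case 1
      then show ?thesis using powi[of i 1] by simp
    next
      case 2
      then show ?thesis using powi[of i "- 1"] nm by (simp add: power_int_minus)
    next
      case 3
      then obtain w D i where w: "g = w i" "(w, D) \<in> mut_equiv m n x B" "1 \<le> i" "i \<le> n"
        by (auto simp: cluster_variables_def)
      have "(w, D) \<in> mut_equiv m n y C" by (rule mut_equiv_trans[OF w(2) xy])
      then show ?thesis using cluster_variable_in_lring[OF K nm sy, of w D i] w nm' by simp
    qed
  next
    case (add a b)
    then show ?case using lring_add I.lev_add by metis
  next
    case (neg a)
    then show ?case using lring_uminus I.lev_uminus by metis
  next
    case (mult a b)
    then show ?case using lring_mult I.lev_mult[OF nz] by metis
  qed
qed

text \<open>Rewriting \<open>y\<^sub>s\<^sup>a\<close> with \<open>a < 0\<close> in the cluster mutated at \<open>s\<close> puts a binomial into the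
  denominator.\<close>

lemma monomial_exponent_nonneg:
  fixes x :: "nat \<Rightarrow> 'f::field_char_0"
  assumes K: "subring_set K" and nm: "n \<le> p" "p \<le> m" and s: "seed_ok K m n x B"
    and yC: "(y, C) \<in> mut_equiv m n x B" and k: "k \<in> {1..n}"
    and u: "u \<in> K" "u \<noteq> 0" and a: "keys a \<subseteq> {1..m}"
    and f: "u * mon (trunc m y) a \<in> cluster_algebra K m p n x B"
  shows "0 \<le> lookup a k"
proof (rule ccontr)
  assume neg: "\<not> 0 \<le> lookup a k"
  interpret laurent_ring K "supp_in {1..m}"
    by unfold_locales (use K submonoid_supp_in in auto)
  have nm': "n \<le> m" and km: "k \<in> {1..m}" using nm k by auto
  have sy: "seed_ok K m n y C" using seed_ok_mut_equiv[OF K nm' s yC] by simp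
  let ?y = "trunc m y" and ?z = "trunc m (mut_clu m k y C)"
  have zC: "(mut_clu m k y C, mut_mat k C) \<in> mut_equiv m n x B"
    using mut_equiv.step[OF yC] k by simp
  obtain q where q: "q \<in> lring K (frozen_exps m p)" "u * mon ?y a = I.lev ?z q"
    using cluster_algebra_in_lring[OF K nm s zC f] by blast
  have kk: "C k k = 0" using sy k skew_symmetrizable_diag by (auto simp: seed_ok_def)
  have lz: "I.lindep K {1..m} ?z" using seed_ok_mutation(1)[OF K nm' sy k] by (simp add: seed_ok_def)
  then have nz: "0 \<notin> range ?z" by (simp add: I.lindep_def)
  have ny: "0 \<notin> range ?y" using sy by (simp add: seed_ok_def I.lindep_def)
  define Q where "Q = exch m k ?y C"
  have z: "?z = ?y(k := inverse (?y k) * Q)"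
    unfolding trunc_mut_clu[OF km] by (simp add: mut_clu_exch Q_def)
  have Qz: "Q = I.lev ?z (binom m C k)"
    unfolding I.lev_binom z Q_def by (simp add: exch_upd kk)
  have Q0: "Q \<noteq> 0" using nonzero_at[OF nz, of k] unfolding z by auto
  have yk: "?y k = Q / ?z k" unfolding z using Q0 nonzero_at[OF ny, of k] by (simp add: field_simps)
  \<comment> \<open>The exponent is \<open>- (N + 1)\<close>, so at least one binomial factor
    appears in the denominator.\<close>
  define N where "N = nat (- lookup a k - 1)"
  have N: "lookup a k = - int (Suc N)" using neg by (simp add: N_def)
  let ?a = "a - single k (lookup a k)"
  have "lookup ?a k = 0" by (simp add: lookup_minus)
  then have "mon ?z ?a = mon ?y ?a" unfolding z by (rule mon_upd)
  then have "mon ?y a = mon ?z ?a * (Q / ?z k) powi lookup a k"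
    using mon_split[OF ny, of a k] yk by simp
  also have "\<dots> = mon ?z ?a * ?z k ^ Suc N / Q ^ Suc N"
    unfolding N power_int_minus power_int_of_nat by (simp add: power_divide)
  also have "mon ?z ?a * ?z k ^ Suc N = mon ?z (?a + single k (int (Suc N)))"
    unfolding mon_add[OF nz] mon_single power_int_of_nat ..
  finally have "mon ?y a * Q ^ Suc N = mon ?z (?a + single k (int (Suc N)))"
    using Q0 by (simp add: field_simps)
  then have "I.lev ?z (q * binom m C k ^ Suc N) = I.lev ?z (single (?a + single k (int (Suc N))) u)"
    by (simp only: I.lev_mult[OF nz] I.lev_power[OF nz] Qz[symmetric] q(2)[symmetric] I.lev_single mult.assoc)
  moreover have "keys (?a + single k (int (Suc N))) \<subseteq> {1..m}"
    using a km by (force simp: in_keys_iff lookup_add lookup_minus lookup_single when_def split: if_splits)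
  then have "single (?a + single k (int (Suc N))) u \<in> lring K (supp_in {1..m})"
    by (intro lring_single u) (simp add: supp_in_def)
  moreover have "q * binom m C k ^ Suc N \<in> lring K (supp_in {1..m})"
    by (intro lring_mult lring_power I.binom_in_lring[OF K]) (use q lring_frozen_supp in auto)
  ultimately have "q * binom m C k ^ Suc N = single (?a + single k (int (Suc N))) u"
    by (intro lindep_inj_on[OF K lz])
  \<comment> \<open>One of the \<open>N + 1\<close> binomial factors is isolated; it would divide a
    nonzero monomial.\<close>
  then have "(single (posv m C k) 1 + single (negv m C k) 1) * (q * binom m C k ^ N)
      = single (?a + single k (int (Suc N))) u"
    unfolding binom_def[symmetric] by (simp add: mult.left_commute)
  moreover have "posv m C k \<noteq> negv m C k"
    using sy k by (intro posv_neq_negv[of m n]) (auto simp: seed_ok_def)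
  ultimately show False using binomial_not_factor u(2) by blast
qed

section \<open>Frozen units and irreducibility of cluster variables\<close>

lemma alg_gen_power:
  assumes "1 \<in> K" "a \<in> alg_gen K G"
  shows "a ^ n \<in> alg_gen K G"
  using assms by (induction n) (auto intro: alg_gen.intros)

lemma alg_gen_prod:
  assumes "1 \<in> K" "\<And>i. i \<in> S \<Longrightarrow> f i \<in> alg_gen K G"
  shows "prod f S \<in> alg_gen K G"
  using assms(2) by (induction S rule: infinite_finite_induct) (auto intro: alg_gen.intros assms(1))

lemma frozen_monomial_in_cluster_algebra:
  assumes K: "1 \<in> K" and nm: "p \<le> m" and e: "keys e \<subseteq> {n<..p}"
    and y: "\<And>i. i \<in> {n<..p} \<Longrightarrow> y i = x i"
  shows "mon (trunc m y) e \<in> cluster_algebra K m p n x B"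
  unfolding mon_def cluster_algebra_def
proof (rule alg_gen_prod[OF K])
  fix i assume "i \<in> keys e"
  then have i: "i \<in> {n<..p}" using e by auto
  then have "trunc m y i = x i" using y nm by (auto simp: trunc_def)
  moreover have "x i \<in> alg_gen K ({x i |i. n < i \<and> i \<le> p} \<union>
      {inverse (x i) |i. n < i \<and> i \<le> p} \<union> {x i |i. p < i \<and> i \<le> m} \<union> cluster_variables m n x B)"
    (is "_ \<in> ?A")
    by (rule alg_gen.gen) (use i in auto)
  moreover have "inverse (x i) \<in> ?A"
    by (rule alg_gen.gen) (use i in auto)
  ultimately show "trunc m y i powi lookup e i \<in> ?A"
    unfolding power_int_def by (simp add: alg_gen_power[OF K])
qed

theorem theorem3p1:
  fixes K :: "'f::field_char_0 set" and X x :: "nat \<Rightarrow> 'f"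
    and B :: "nat \<Rightarrow> nat \<Rightarrow> int" and m p n :: nat and z :: 'f
  assumes "1 \<le> n" and "n \<le> p" and "p \<le> m" and "1 < m"
    and "base_ring K"
    and "rational_function_field K m X"
    and "is_seed K m n x B"
    and "z \<in> cluster_variables m n x B"
  shows "irreducible_in (cluster_algebra K m p n x B) z"
proof -
  let ?A = "cluster_algebra K m p n x B"
  have K: "subring_set K" by (rule base_ring_subring) fact
  have nm: "n \<le> m" using assms by simp
  have s: "seed_ok K m n x B"
    using assms(7) alg_indep_lindep[OF K] nonzero_cols_connected[of m n B] assms(4) nm
    by (auto simp: is_seed_def seed_ok_def)
  obtain y C k where z: "z = y k" and yC: "(y, C) \<in> mut_equiv m n x B" and k: "k \<in> {1..n}"
    using assms(8) by (auto simp: cluster_variables_def)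
  have km: "k \<in> {1..m}" using k nm by auto
  have sy: "seed_ok K m n y C" and frozen: "\<And>i. i \<notin> {1..n} \<Longrightarrow> y i = x i"
    using seed_ok_mut_equiv[OF K nm s yC] by auto
  let ?y = "trunc m y"
  have ly: "I.lindep K {1..m} ?y" using sy by (simp add: seed_ok_def)
  then have ny: "0 \<notin> range ?y" by (simp add: I.lindep_def)
  interpret laurent_ring K "supp_in {1..m}"
    by unfold_locales (use K submonoid_supp_in in auto)
  have K1: "1 \<in> K" using K by (simp add: subring_set_def)
  have zk: "z = mon ?y (single k 1)" using km by (simp add: z trunc_def)
  have zA: "z \<in> ?A"
    using assms(8) unfolding cluster_algebra_def by (intro alg_gen.gen) simp
  note nonneg = monomial_exponent_nonneg[OF K assms(2,3) s yC]
  have "\<not> unit_in ?A z"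
  proof
    assume "unit_in ?A z"
    then obtain g where g: "g \<in> ?A" "z * g = 1" by (auto simp: unit_in_def)
    then have "g = inverse z" by (metis inverse_unique)
    \<comment> \<open>An inverse of \<open>y k\<close> would be a monomial with exponent
      \<open>- 1\<close> in a mutable direction.\<close>
    then have "g = 1 * mon ?y (- single k 1)" by (simp add: mon_uminus[OF ny] zk)
    then have "1 * mon ?y (- single k 1) \<in> ?A" using g(1) by (simp only:)
    then have "0 \<le> lookup (- single k (1::int)) k"
      by (intro nonneg[OF k K1]) (use km in auto)
    then show False by simp
  qed
  moreover have "unit_in ?A f \<or> unit_in ?A g" if f: "f \<in> ?A" and g: "g \<in> ?A" and fg: "z = f * g" for f g
  proof -
    obtain qf where qf: "qf \<in> lring K (frozen_exps m p)" "f = I.lev ?y qf"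
      using cluster_algebra_in_lring[OF K assms(2,3) s yC f] by blast
    obtain qg where qg: "qg \<in> lring K (frozen_exps m p)" "g = I.lev ?y qg"
      using cluster_algebra_in_lring[OF K assms(2,3) s yC g] by blast
    have prod: "qf * qg = single (single k 1) 1"
    proof (rule lindep_inj_on[OF K ly])
      show "qf * qg \<in> lring K (supp_in {1..m})"
        by (rule lring_mult) (use qf qg lring_frozen_supp in auto)
      show "single (single k 1) 1 \<in> lring K (supp_in {1..m})"
        by (rule lring_single_1) (use km in \<open>simp add: supp_in_def\<close>)
      show "I.lev ?y (qf * qg) = I.lev ?y (single (single k 1) 1)"
        unfolding I.lev_mult[OF ny] I.lev_single_1 zk[symmetric] fg qf(2) qg(2) ..
    qed
    obtain a u where a: "qf = single a u" "u \<noteq> 0"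
      by (rule factor_of_single[OF prod]) auto
    obtain b v where b: "qg = single b v" "v \<noteq> 0"
      by (rule factor_of_single[OF prod[unfolded mult.commute[of qf]]]) auto
    have "single (a + b) (u * v) = single (single k 1) 1" using prod a b by (simp add: mult_single)
    then have ab: "a + b = single k 1" and uv: "u * v = 1"
      using a b by (metis keys_single mult_eq_0_iff singleton_inject zero_neq_one, metis keys_single lookup_single_eq mult_eq_0_iff singleton_inject zero_neq_one)
    have aE: "a \<in> frozen_exps m p" "u \<in> K" and bE: "b \<in> frozen_exps m p" "v \<in> K"
      using qf(1) qg(1) a b by (auto simp: lring_def dest: spec[of _ a] spec[of _ b])
    have f_eq: "f = u * mon ?y a" and g_eq: "g = v * mon ?y b"
      by (simp_all add: qf(2) qg(2) a(1) b(1) I.lev_single)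
    have keys: "keys a \<subseteq> {1..m}" "keys b \<subseteq> {1..m}" using aE bE by (auto simp: frozen_exps_def)
    have nn: "0 \<le> lookup a i \<and> 0 \<le> lookup b i" if "i \<in> {1..n} \<or> i \<in> {p<..m}" for i
      using that
    proof
      assume i: "i \<in> {1..n}"
      show ?thesis
        using nonneg[OF i aE(2) a(2) keys(1) f[unfolded f_eq]]
          nonneg[OF i bE(2) b(2) keys(2) g[unfolded g_eq]] by simp
    next
      assume "i \<in> {p<..m}"
      then show ?thesis using aE bE by (auto simp: frozen_exps_def)
    qed
    have sum: "lookup a i + lookup b i = (if i = k then 1 else 0)" for i
      using arg_cong[OF ab, of "\<lambda>e. lookup e i"] by (auto simp: lookup_add lookup_single when_def)
    \<comment> \<open>The inverse coefficient \<open>d\<close> is the coefficient of the other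
      factor, so it lies in \<open>K\<close> also when \<open>K\<close> is the ring of integers. The
      remaining monomial involves only frozen variables that are invertible in the algebra.\<close>
    have unit: "unit_in ?A (c * mon ?y e)"
      if ce: "c \<in> K" "d \<in> K" "c * d = 1" "keys e \<subseteq> {1..m}" "lookup e k = 0" "c * mon ?y e \<in> ?A"
        and e0: "\<And>i. i \<in> {1..n} \<or> i \<in> {p<..m} \<Longrightarrow> i \<noteq> k \<Longrightarrow> lookup e i = 0" for c d e
    proof -
      have "keys e \<subseteq> {n<..p}"
      proof
        fix i assume i: "i \<in> keys e"
        then have "i \<in> {1..m}" "\<not> (i \<in> {1..n} \<or> i \<in> {p<..m})"
          using ce(4,5) e0[of i] by (auto simp: in_keys_iff)
        then show "i \<in> {n<..p}" by auto
      qed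
      then have "mon ?y (- e) \<in> ?A"
        by (intro frozen_monomial_in_cluster_algebra[OF K1 assms(3)]) (use frozen in auto)
      moreover have "d \<in> ?A" unfolding cluster_algebra_def by (intro alg_gen.base ce)
      ultimately have "d * mon ?y (- e) \<in> ?A"
        unfolding cluster_algebra_def by (intro alg_gen.mult)
      moreover have "c * mon ?y e * (d * mon ?y (- e)) = 1"
        using mon_neq_0[OF ny, of e] ce(3) by (simp add: mon_uminus[OF ny] field_simps)
      ultimately show ?thesis using ce(6) unfolding unit_in_def by blast
    qed
    have zero: "lookup a i = 0 \<and> lookup b i = 0" if "i \<in> {1..n} \<or> i \<in> {p<..m}" "i \<noteq> k" for i
      using nn[OF that(1)] sum[of i] that(2) by simp
    \<comment> \<open>The two exponents at \<open>k\<close> are nonnegative integers with sum 1, so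
      one factor does not involve \<open>y k\<close>; that factor is the unit.\<close>
    have "lookup a k = 0 \<or> lookup b k = 0" using nn[of k] sum[of k] k by auto
    then show ?thesis
    proof
      assume "lookup a k = 0"
      then show ?thesis
        unfolding f_eq using unit[OF aE(2) bE(2) uv keys(1) _ f[unfolded f_eq]] zero by blast
    next
      assume "lookup b k = 0"
      moreover have "v * u = 1" using uv by (simp add: mult.commute)
      ultimately show ?thesis
        unfolding g_eq using unit[OF bE(2) aE(2) _ keys(2) _ g[unfolded g_eq]] zero by blast
    qed
  qed
  ultimately show ?thesis using zA unfolding irreducible_in_def by blast
qed

end
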